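(* Let $F \leq F'' \leq F' \leq \hat F \leq \mathrm{Sym}(\Omega)$ be permutation groups such that (a) $F''$ has index two in $F'$, and (b) the type-preserving subgroup $G(F,F'')^\star$ is simple. Then $N(F,F')$ is a simple subgroup of index eight in $G(F,F')$. In particular (taking $F''=F$): if $F$ has index two in $F'$ and $F$ is transitive and generated by its point stabilizers, then $G(F,F')$ has a simple subgroup of index eight.
   Context: Standing notation. $\Omega$ is a finite set with $d=|\Omega|\geq 3$, $\mathcal{T}_d$ is the $d$-regular tree with vertex set $V$ and set $E$ of non-oriented edges, and $\mathrm{Aut}(\mathcal{T}_d)$ carries the permutation topology. Fix a coloring $c:E\to\Omega$ such that for every vertex $v$ its restriction $c_v$ to the set $E(v)$ of edges containing $v$ is a bijection onto $\Omega$. For $g\in\mathrm{Aut}(\mathcal{T}_d)$ and $v\in V$, the local permutation is $\sigma(g,v)=c_{gv}\circ g_v\circ c_v^{-1}\in\mathrm{Sym}(\Omega)$, where $g_v:E(v)\to E(gv)$ is induced by $g$. For $F\leq\mathrm{Sym}(\Omega)$: $U(F)=\{g:\sigma(g,v)\in F \ \forall v\}$; $G(F)=\{g:\sigma(g,v)\in F \text{ for all but finitely many } v\}$; $\hat F$ is the subgroup of permutations preserving each $F$-orbit. For $F\leq F'\leq\hat F$, $G(F,F')=G(F)\cap U(F')$. For a group $G$ acting on a tree, $G^\star$ is the subgroup preserving the natural bipartition of the vertex set, and $G_e$ is the pointwise stabilizer of an edge $e$. $N(F,F')$ denotes the subgroup of $G(F,F')$ generated by the derived subgroups $[G(F,F')_e,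 G(F,F')_e]$, $e\in E$. *)

theory Defs
  imports "HOL-Algebra.Algebra"
begin

definition is_walk :: "('v \<Rightarrow> 'v \<Rightarrow> bool) \<Rightarrow> 'v list \<Rightarrow> 'v \<Rightarrow> 'v \<Rightarrow> bool" where
  "is_walk adj xs u v \<longleftrightarrow> xs \<noteq> [] \<and> hd xs = u \<and> last xs = v \<and> successively adj xs"

definition is_tree :: "('v \<Rightarrow> 'v \<Rightarrow> bool) \<Rightarrow> bool" where
  "is_tree adj \<longleftrightarrow>
     (\<forall>u v. adj u v \<longrightarrow> adj v u) \<and> (\<forall>v. \<not> adj v v) \<and>
     (\<forall>u v. \<exists>xs. is_walk adj xs u v) \<and>
     \<not> (\<exists>xs. length xs \<ge> 4 \<and> successively adj xs \<and> hd xs = last xs \<and> distinct (butlast xs))"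

definition edges :: "('v \<Rightarrow> 'v \<Rightarrow> bool) \<Rightarrow> 'v set set" where
  "edges adj = {{u, v} | u v. adj u v}"

definition edges_at :: "('v \<Rightarrow> 'v \<Rightarrow> bool) \<Rightarrow> 'v \<Rightarrow> 'v set set" where
  "edges_at adj v = {e \<in> edges adj. v \<in> e}"

text \<open>Omega is the (finite) universe of the type 'a; a legal colouring restricts at every
  vertex to a bijection from the incident edges onto Omega.\<close>

definition legal_coloring :: "('v \<Rightarrow> 'v \<Rightarrow> bool) \<Rightarrow> ('v set \<Rightarrow> 'a) \<Rightarrow> bool" where
  "legal_coloring adj c \<longleftrightarrow> (\<forall>v. bij_betw c (edges_at adj v) (UNIV :: 'a set))"

definition aut :: "('v \<Rightarrow> 'v \<Rightarrow> bool) \<Rightarrow> ('v \<Rightarrow> 'v) set" where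
  "aut adj = {g. bij g \<and> (\<forall>u v. adj u v \<longleftrightarrow> adj (g u) (g v))}"

definition autG :: "('v \<Rightarrow> 'v \<Rightarrow> bool) \<Rightarrow> ('v \<Rightarrow> 'v) monoid" where
  "autG adj = (BijGroup (UNIV :: 'v set)) \<lparr>carrier := aut adj\<rparr>"

abbreviation SymG :: "('a \<Rightarrow> 'a) monoid" where
  "SymG \<equiv> BijGroup (UNIV :: 'a set)"

definition local_perm :: "('v \<Rightarrow> 'v \<Rightarrow> bool) \<Rightarrow> ('v set \<Rightarrow> 'a) \<Rightarrow> ('v \<Rightarrow> 'v) \<Rightarrow> 'v \<Rightarrow> 'a \<Rightarrow> 'a" where
  "local_perm adj c g v = (\<lambda>\<omega>. c (g ` (the_inv_into (edges_at adj v) c \<omega>)))"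

definition U_grp :: "('v \<Rightarrow> 'v \<Rightarrow> bool) \<Rightarrow> ('v set \<Rightarrow> 'a) \<Rightarrow> ('a \<Rightarrow> 'a) set \<Rightarrow> ('v \<Rightarrow> 'v) set" where
  "U_grp adj c F = {g \<in> aut adj. \<forall>v. local_perm adj c g v \<in> F}"

definition G_grp :: "('v \<Rightarrow> 'v \<Rightarrow> bool) \<Rightarrow> ('v set \<Rightarrow> 'a) \<Rightarrow> ('a \<Rightarrow> 'a) set \<Rightarrow> ('v \<Rightarrow> 'v) set" where
  "G_grp adj c F = {g \<in> aut adj. finite {v. local_perm adj c g v \<notin> F}}"

definition G2_grp :: "('v \<Rightarrow> 'v \<Rightarrow> bool) \<Rightarrow> ('v set \<Rightarrow> 'a) \<Rightarrow> ('a \<Rightarrow> 'a) set \<Rightarrow> ('a \<Rightarrow> 'a) set \<Rightarrow> ('v \<Rightarrow> 'v) set" where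
  "G2_grp adj c F F' = G_grp adj c F \<inter> U_grp adj c F'"

definition hat :: "('a \<Rightarrow> 'a) set \<Rightarrow> ('a \<Rightarrow> 'a) set" where
  "hat F = {\<sigma>. bij \<sigma> \<and> (\<forall>x. \<exists>f \<in> F. f x = \<sigma> x)}"

text \<open>G-star: elements preserving the bipartition (each vertex moved an even distance).\<close>
definition type_pres :: "('v \<Rightarrow> 'v \<Rightarrow> bool) \<Rightarrow> ('v \<Rightarrow> 'v) set \<Rightarrow> ('v \<Rightarrow> 'v) set" where
  "type_pres adj H = {g \<in> H. \<forall>v. \<exists>xs. is_walk adj xs v (g v) \<and> even (length xs - 1)}"

definition edge_stab :: "('v \<Rightarrow> 'v) set \<Rightarrow> 'v set \<Rightarrow> ('v \<Rightarrow> 'v) set" where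
  "edge_stab H e = {g \<in> H. \<forall>x \<in> e. g x = x}"

definition N_grp :: "('v \<Rightarrow> 'v \<Rightarrow> bool) \<Rightarrow> ('v set \<Rightarrow> 'a) \<Rightarrow> ('a \<Rightarrow> 'a) set \<Rightarrow> ('a \<Rightarrow> 'a) set \<Rightarrow> ('v \<Rightarrow> 'v) set" where
  "N_grp adj c F F' = generate (autG adj)
     (\<Union>e \<in> edges adj. derived (autG adj) (edge_stab (G2_grp adj c F F') e))"

section \<open>Abstract group notions (valid also for infinite groups)\<close>

definition simple_abs :: "('g, 'b) monoid_scheme \<Rightarrow> bool" where
  "simple_abs G \<longleftrightarrow> group G \<and> carrier G \<noteq> {\<one>\<^bsub>G\<^esub>} \<and>
     (\<forall>H. H \<lhd> G \<longrightarrow> H = carrier G \<or> H = {\<one>\<^bsub>G\<^esub>})"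

definition index :: "('g, 'b) monoid_scheme \<Rightarrow> 'g set \<Rightarrow> nat" where
  "index G H = card (rcosets\<^bsub>G\<^esub> H)"

definition transitive_on :: "('a \<Rightarrow> 'a) set \<Rightarrow> bool" where
  "transitive_on F \<longleftrightarrow> (\<forall>x y. \<exists>f \<in> F. f x = y)"

definition gen_by_point_stabs :: "('a \<Rightarrow> 'a) set \<Rightarrow> bool" where
  "gen_by_point_stabs F \<longleftrightarrow> generate SymG (\<Union>x. {f \<in> F. f x = x}) = F"

end

theory Submission
  imports Defs
begin

text \<open>
  For a type-preserving \<open>g\<close> in \<open>G(F,F')\<close> call a vertex singular if the local
  permutation of \<open>g\<close> there lies outside \<open>F''\<close>. As \<open>F''\<close> has index two, the number of singular vertices of each type is additive mod 2 under composition. The subgroup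
  \<open>Ker\<close> where both parities vanish has index \<open>2 * 2 * 2 = 8\<close>, the first factor being the exchange
  of types.

  If \<open>h \<noteq> id\<close> lies in a normal subgroup of \<open>Ker\<close>, its commutator with a nontrivial element of
  \<open>S = G(F,F'')\<^sup>\<star>\<close> supported on a half-tree that \<open>h\<close> displaces and that avoids the singular
  vertices of \<open>h\<close> is a nontrivial element of \<open>S\<close>. Since \<open>S\<close> is simple, every nontrivial normal
  subgroup of \<open>Ker\<close> contains \<open>S\<close>, hence so does the intersection of its conjugates, and a
  normal subgroup containing \<open>S\<close> allows singular vertices to be cancelled in pairs, so it is all of
  \<open>Ker\<close>. Finally \<open>N(F,F')\<close> is a nontrivial normal subgroup of \<open>Ker\<close>.

  For the second part, \<open>S = U(F)\<^sup>\<star>\<close> is simple by Tits' argument: a nontrivial normal subgroup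
  contains a translation \<open>h\<close>, and an element supported on a half-tree with pairwise disjoint
  \<open>h\<close>-translates is a commutator with \<open>h\<close>.
\<close>

section \<open>Groups of permutations\<close>

text \<open>A nontrivial element of \<open>S\<close> supported on a half-tree requires some t
  \<noteq> id in F'' that fixes a colour. Its existence is extracted from simplicity of
  \<open>S\<close>: if F'' acted freely, the colour-preserving elements would form a proper
  nontrivial normal subgroup. The hypothesis F' \<le> hat F serves to realise a permutation t at a
  single vertex: for each colour a some element of F agrees with t at a, and it is used on the whole
  branch behind colour a, so no second singular vertex arises.

  Singular vertices are cancelled with elements having exactly one of them. Such elements lie
  outside \<open>Ker\<close>, so cancellation needs invariance under all type-preserving elements,
  whereas a normal subgroup of \<open>Ker\<close> is only invariant under \<open>Ker\<close>; hence
  the intersection of conjugates. An exchange of types swaps the two parities, so the index is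
  counted with an invariant of cosets and not with a homomorphism.

  In Tits' argument the conjugators must preserve types, so half-trees of both types have to be
  reached; the inverse of a translation supplies the missing type.\<close>

abbreviation finv :: "('x \<Rightarrow> 'x) \<Rightarrow> 'x \<Rightarrow> 'x" where
  "finv \<equiv> inv_into UNIV"

definition perm_group :: "('x \<Rightarrow> 'x) set \<Rightarrow> bool" where
  "perm_group A \<longleftrightarrow> A \<subseteq> {g. bij g} \<and> id \<in> A \<and> (\<forall>g\<in>A. \<forall>h\<in>A. g \<circ> h \<in> A) \<and> (\<forall>g\<in>A. finv g \<in> A)"

lemma perm_groupD:
  assumes "perm_group A"
  shows "g \<in> A \<Longrightarrow> bij g" "id \<in> A" "g \<in> A \<Longrightarrow> h \<in> A \<Longrightarrow> g \<circ> h \<in> A" "g \<in> A \<Longrightarrow> finv g \<in> A"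
  using assms by (auto simp: perm_group_def)

definition perm_normal :: "('x \<Rightarrow> 'x) set \<Rightarrow> ('x \<Rightarrow> 'x) set \<Rightarrow> bool" where
  "perm_normal A Y \<longleftrightarrow> perm_group A \<and> A \<subseteq> Y \<and> (\<forall>g\<in>Y. \<forall>h\<in>A. g \<circ> h \<circ> finv g \<in> A)"

text \<open>With the carrier left free, one notation serves \<open>SymG\<close>, \<open>autG\<close>
  and all their subsets seen as groups; the carrier updates of the theorem reduce to it.\<close>

abbreviation PG :: "('x \<Rightarrow> 'x) set \<Rightarrow> ('x \<Rightarrow> 'x) monoid" where
  "PG Y \<equiv> (BijGroup UNIV)\<lparr>carrier := Y\<rparr>"

lemma Bij_UNIV: "Bij UNIV = {f. bij f}"
  by (auto simp: Bij_def)

lemma PG_mult: "bij f \<Longrightarrow> bij g \<Longrightarrow> f \<otimes>\<^bsub>BijGroup UNIV\<^esub> g = f \<circ> g"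
  by (auto simp: BijGroup_def Bij_UNIV compose_def fun_eq_iff)

lemma PG_one: "\<one>\<^bsub>BijGroup UNIV\<^esub> = id"
  by (auto simp: BijGroup_def fun_eq_iff)

lemma PG_group: assumes "perm_group Y" shows "group (PG Y)"
proof (rule groupI)
  fix x y z assume "x \<in> carrier (PG Y)" "y \<in> carrier (PG Y)" "z \<in> carrier (PG Y)"
  then have xyz: "x \<in> Y" "y \<in> Y" "z \<in> Y" by auto
  note b = perm_groupD(1)[OF assms xyz(1)] perm_groupD(1)[OF assms xyz(2)] perm_groupD(1)[OF assms xyz(3)]
  show "x \<otimes>\<^bsub>PG Y\<^esub> y \<in> carrier (PG Y)" using b perm_groupD(3)[OF assms] xyz by (simp add: PG_mult)
  show "x \<otimes>\<^bsub>PG Y\<^esub> y \<otimes>\<^bsub>PG Y\<^esub> z = x \<otimes>\<^bsub>PG Y\<^esub> (y \<otimes>\<^bsub>PG Y\<^esub> z)"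
    using b by (simp add: PG_mult bij_comp comp_assoc)
next
  show "\<one>\<^bsub>PG Y\<^esub> \<in> carrier (PG Y)" using assms by (simp add: PG_one perm_groupD)
next
  fix x assume "x \<in> carrier (PG Y)"
  then have x: "x \<in> Y" "bij x" "finv x \<in> Y" using perm_groupD[OF assms] by auto
  show "\<one>\<^bsub>PG Y\<^esub> \<otimes>\<^bsub>PG Y\<^esub> x = x" using x by (simp add: PG_one PG_mult)
  show "\<exists>y\<in>carrier (PG Y). y \<otimes>\<^bsub>PG Y\<^esub> x = \<one>\<^bsub>PG Y\<^esub>"
    using x by (intro bexI[of _ "finv x"]) (auto simp: PG_one PG_mult bij_imp_bij_inv bij_is_inj)
qed

lemma PG_inv: assumes "perm_group Y" "x \<in> Y" shows "inv\<^bsub>PG Y\<^esub> x = finv x"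
proof -
  interpret group "PG Y" using PG_group assms(1) .
  have "bij x" "finv x \<in> Y" using assms perm_groupD by auto
  then show ?thesis using assms(2)
    by (intro inv_equality) (auto simp: PG_one PG_mult bij_imp_bij_inv bij_is_inj)
qed

lemma subgroup_PG_iff:
  assumes "perm_group Y"
  shows "subgroup A (PG Y) \<longleftrightarrow> perm_group A \<and> A \<subseteq> Y"
proof
  interpret group "PG Y" using PG_group assms .
  assume "subgroup A (PG Y)"
  then interpret A: subgroup A "PG Y" .
  have sub: "A \<subseteq> Y" using A.subset by simp
  then have b: "g \<in> A \<Longrightarrow> bij g" for g using perm_groupD(1)[OF assms] by auto
  show "perm_group A \<and> A \<subseteq> Y"
    unfolding perm_group_def
  proof (intro conjI ballI)
    show "id \<in> A" using A.one_closed by (simp add: PG_one)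
    show "g \<circ> h \<in> A" if "g \<in> A" "h \<in> A" for g h
      using A.m_closed[OF that] b that by (simp add: PG_mult)
    show "finv g \<in> A" if "g \<in> A" for g
      using A.m_inv_closed[OF that] unfolding PG_inv[OF assms subsetD[OF sub that]] .
  qed (use b sub in auto)
next
  assume a: "perm_group A \<and> A \<subseteq> Y"
  interpret group "PG Y" using PG_group assms .
  show "subgroup A (PG Y)"
  proof (rule subgroupI)
    show "inv\<^bsub>PG Y\<^esub> g \<in> A" if "g \<in> A" for g
      using PG_inv[OF assms, of g] that a perm_groupD(4)[of A g] by (auto simp: subset_iff)
    show "g \<otimes>\<^bsub>PG Y\<^esub> h \<in> A" if "g \<in> A" "h \<in> A" for g h
      using that a perm_groupD(1,3)[of A] by (simp add: PG_mult)
  qed (use a perm_groupD(2) in auto)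
qed

lemma normal_PG_iff:
  assumes "perm_group Y"
  shows "A \<lhd> PG Y \<longleftrightarrow> perm_normal A Y"
proof -
  interpret group "PG Y" using PG_group assms .
  have "x \<otimes>\<^bsub>PG Y\<^esub> h \<otimes>\<^bsub>PG Y\<^esub> inv\<^bsub>PG Y\<^esub> x = x \<circ> h \<circ> finv x" if "x \<in> Y" "h \<in> Y" for x h
    using that perm_groupD(1)[OF assms] by (simp add: PG_mult PG_inv assms bij_comp bij_imp_bij_inv)
  then show ?thesis
    unfolding normal_inv_iff subgroup_PG_iff[OF assms] perm_normal_def
    by (auto simp: subset_iff)
qed

lemma simple_PG_iff:
  assumes "perm_group Y"
  shows "simple_abs (PG Y) \<longleftrightarrow> Y \<noteq> {id} \<and> (\<forall>A. perm_normal A Y \<longrightarrow> A = Y \<or> A = {id})"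
  using PG_group[OF assms] by (simp add: simple_abs_def normal_PG_iff[OF assms] PG_one)

lemma index_PG:
  assumes "perm_group Y" "A \<subseteq> Y"
  shows "index (PG Y) A = card ((\<lambda>g. (\<lambda>h. h \<circ> g) ` A) ` Y)"
proof -
  have "A #>\<^bsub>PG Y\<^esub> g = (\<lambda>h. h \<circ> g) ` A" if "g \<in> Y" for g
  proof -
    have "h \<otimes>\<^bsub>PG Y\<^esub> g = h \<circ> g" if "h \<in> A" for h
      using that \<open>g \<in> Y\<close> assms perm_groupD(1)[OF assms(1)] by (auto simp: PG_mult)
    then show ?thesis unfolding r_coset_def by (auto simp: image_iff)
  qed
  then have "rcosets\<^bsub>PG Y\<^esub> A = (\<lambda>g. (\<lambda>h. h \<circ> g) ` A) ` Y"
    unfolding RCOSETS_def by (auto simp: image_iff)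
  then show ?thesis by (simp add: index_def)
qed

lemma finv_finv [simp]: "bij g \<Longrightarrow> finv (finv g) = g"
  by (rule inv_inv_eq)

lemma finv_conj:
  assumes "bij g" "bij h"
  shows "finv (g \<circ> h \<circ> finv g) = g \<circ> finv h \<circ> finv g"
  using o_inv_distrib[OF bij_comp[OF assms(2,1)] bij_imp_bij_inv[OF assms(1)]] o_inv_distrib[OF assms] assms
  by (simp add: comp_assoc)

text \<open>A conjugate subgroup in the form of a preimage: membership unfolds without a witness,
  which suits the intersection of all conjugates and the invariance of \<open>N\<close>.\<close>

lemma perm_group_conj:
  assumes "perm_group A" "bij g"
  shows "perm_group {x. g \<circ> x \<circ> finv g \<in> A}"
proof -
  have i: "finv g \<circ> g = id" "g \<circ> finv g = id" using assms(2) by (simp_all add: bij_is_inj bij_is_surj surj_iff[symmetric])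
  have b: "bij x" if "g \<circ> x \<circ> finv g \<in> A" for x
  proof -
    have "bij (finv g \<circ> (g \<circ> x \<circ> finv g) \<circ> g)"
      by (rule bij_comp[OF assms(2) bij_comp[OF perm_groupD(1)[OF assms(1) that] bij_imp_bij_inv[OF assms(2)]]])
    moreover have "finv g \<circ> (g \<circ> x \<circ> finv g) \<circ> g = x"
      using i by (metis comp_assoc comp_id id_comp)
    ultimately show ?thesis by simp
  qed
  show ?thesis
    unfolding perm_group_def
  proof (intro conjI ballI; clarsimp)
    show "bij x" if "g \<circ> x \<circ> finv g \<in> A" for x using b that .
    show "g \<circ> finv g \<in> A" using i perm_groupD(2)[OF assms(1)] by simp
    show "g \<circ> (x \<circ> y) \<circ> finv g \<in> A" if "g \<circ> x \<circ> finv g \<in> A" "g \<circ> y \<circ> finv g \<in> A" for x y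
    proof -
      have "(g \<circ> x \<circ> finv g) \<circ> (g \<circ> y \<circ> finv g) = g \<circ> (x \<circ> y) \<circ> finv g"
        using i by (metis comp_assoc comp_id)
      then show ?thesis using perm_groupD(3)[OF assms(1) that] by simp
    qed
    show "g \<circ> finv x \<circ> finv g \<in> A" if "g \<circ> x \<circ> finv g \<in> A" for x
    proof -
      have "finv (g \<circ> x \<circ> finv g) = finv (finv g) \<circ> (finv x \<circ> finv g)"
        using b[OF that] assms(2) by (simp add: o_inv_distrib bij_comp bij_imp_bij_inv)
      then have "finv (g \<circ> x \<circ> finv g) = g \<circ> finv x \<circ> finv g"
        using assms(2) by (simp add: inv_inv_eq comp_assoc)
      then show ?thesis using perm_groupD(4)[OF assms(1) that] by simp
    qed
  qed
qed

lemma PG_SymG: "SymG = PG {f. bij f}"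
  by (simp add: BijGroup_def Bij_UNIV)

lemma perm_group_bij: "perm_group {f. bij f}"
  by (auto simp: perm_group_def bij_comp bij_imp_bij_inv)

lemma subgroup_SymG: "subgroup A SymG \<Longrightarrow> perm_group A"
  using subgroup_PG_iff[OF perm_group_bij] PG_SymG by metis

text \<open>Outside a subgroup of index two there is a single coset. The second claim is the source
  of every parity statement about singular vertices.\<close>

lemma index_two:
  fixes Y A :: "('x \<Rightarrow> 'x) set"
  assumes Y: "perm_group Y" and A: "perm_group A" "A \<subseteq> Y" and i: "index (PG Y) A = 2"
  shows "\<exists>g\<in>Y. g \<notin> A" "f \<in> Y - A \<Longrightarrow> g \<in> Y - A \<Longrightarrow> g \<circ> f \<in> A"
proof -
  define co where "co g = (\<lambda>h. h \<circ> g) ` A" for g :: "'x \<Rightarrow> 'x"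
  have card: "card (co ` Y) = 2" using index_PG[OF Y A(2)] i by (simp add: co_def)
  have self: "g \<in> co g" for g
    unfolding co_def by (rule image_eqI[of _ _ id]) (use perm_groupD(2)[OF A(1)] in auto)
  have coid: "co id = A" by (simp add: co_def)
  have coA: "co g = A" if "g \<in> A" for g
  proof
    show "co g \<subseteq> A" using that perm_groupD(3)[OF A(1)] by (auto simp: co_def)
    show "A \<subseteq> co g"
    proof
      fix h assume h: "h \<in> A"
      have "h = (h \<circ> finv g) \<circ> g"
        using perm_groupD(1)[OF A(1) that] by (simp add: comp_assoc bij_is_inj)
      moreover have "h \<circ> finv g \<in> A" using perm_groupD(3,4)[OF A(1)] h that by blast
      ultimately show "h \<in> co g" unfolding co_def by blast
    qed
  qed
  show "\<exists>g\<in>Y. g \<notin> A"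
  proof (rule ccontr)
    assume "\<not> ?thesis"
    then have "co ` Y \<subseteq> {A}" using coA by blast
    then have "card (co ` Y) \<le> 1" using card_mono[of "{A}" "co ` Y"] by simp
    then show False using card by simp
  qed
  show "g \<circ> f \<in> A" if f: "f \<in> Y - A" and g: "g \<in> Y - A"
  proof -
    have f': "finv f \<in> Y" "finv f \<notin> A"
      using perm_groupD(4)[OF Y] perm_groupD(4)[OF A(1), of "finv f"] f perm_groupD(1)[OF Y, of f]
      by (auto simp: inv_inv_eq)
    \<comment> \<open>Neither \<open>g\<close> nor \<open>finv f\<close> lies in \<open>A\<close>;
      if their cosets differed, \<open>A\<close> itself would be a third one.\<close>
    have "co g = co (finv f)"
    proof (rule ccontr)
      assume ne: "co g \<noteq> co (finv f)"
      have "A \<noteq> co g" "A \<noteq> co (finv f)" using self[of g] self[of "finv f"] f' g by auto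
      then have "card {A, co g, co (finv f)} = 3" using ne by simp
      moreover have "{A, co g, co (finv f)} \<subseteq> co ` Y"
        using coid perm_groupD(2)[OF Y] f' g by blast
      \<comment> \<open>\<open>card\<close> is 0 on infinite sets, so the value 2 certifies
        finiteness.\<close>
      moreover have "finite (co ` Y)" by (rule ccontr) (use card in simp)
      ultimately show False using card card_mono[of "co ` Y" "{A, co g, co (finv f)}"] by simp
    qed
    then have "g \<in> co (finv f)" using self by blast
    then obtain h where "h \<in> A" "g = h \<circ> finv f" by (auto simp: co_def)
    moreover have "h \<circ> finv f \<circ> f = h"
      using perm_groupD(1)[OF Y, of f] f by (simp add: comp_assoc bij_is_inj)
    ultimately show ?thesis by simp
  qed
qed

text \<open>Lets cosets be counted through an invariant with the same fibres.\<close>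

lemma card_image_cong:
  assumes "\<And>x y. x \<in> A \<Longrightarrow> y \<in> A \<Longrightarrow> f x = f y \<longleftrightarrow> g x = g y"
  shows "card (f ` A) = card (g ` A)"
proof -
  have "bij_betw (\<lambda>z. g (inv_into A f z)) (f ` A) (g ` A)"
    unfolding bij_betw_def
  proof
    have r: "inv_into A f (f x) \<in> A" "f (inv_into A f (f x)) = f x" if "x \<in> A" for x
      using that by (auto intro: inv_into_into f_inv_into_f)
    have e: "g (inv_into A f (f x)) = g x" if "x \<in> A" for x
      using assms[OF r(1)[OF that] that] r(2)[OF that] by simp
    show "inj_on (\<lambda>z. g (inv_into A f z)) (f ` A)"
      using e assms by (auto intro!: inj_onI)
    show "(\<lambda>z. g (inv_into A f z)) ` f ` A = g ` A" using e by (auto simp: image_iff)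
  qed
  then show ?thesis by (rule bij_betw_same_card)
qed

lemma perm_group_generate:
  assumes "perm_group Y" "A \<subseteq> Y"
  shows "perm_group (generate (PG Y) A)" "A \<subseteq> generate (PG Y) A"
proof -
  interpret group "PG Y" using PG_group assms(1) .
  have "subgroup (generate (PG Y) A) (PG Y)" using generate_is_subgroup[of A] assms by simp
  then show "perm_group (generate (PG Y) A)" using subgroup_PG_iff assms(1) by blast
  show "A \<subseteq> generate (PG Y) A" by (auto intro: generate.incl)
qed

lemma generate_least:
  assumes "perm_group Y" "A \<subseteq> Y" "perm_group B" "A \<subseteq> B"
  shows "generate (PG Y) A \<subseteq> B"
proof
  fix x assume "x \<in> generate (PG Y) A"
  then show "x \<in> B"
  proof induction
    case one
    then show ?case using perm_groupD(2)[OF assms(3)] by (simp add: PG_one id_def)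
  next
    case (incl h)
    then show ?case using assms by blast
  next
    case (inv h)
    then show ?case using PG_inv[OF assms(1), of h] perm_groupD(4)[OF assms(3), of h] assms(2,4) by (auto simp: subset_iff)
  next
    case (eng h1 h2)
    then show ?case using perm_groupD(1,3)[OF assms(3)] by (simp add: PG_mult comp_def)
  qed
qed

definition commutators :: "('x \<Rightarrow> 'x) set \<Rightarrow> ('x \<Rightarrow> 'x) set" where
  "commutators A = {g \<circ> h \<circ> finv g \<circ> finv h | g h. g \<in> A \<and> h \<in> A}"

lemma derived_PG:
  assumes "perm_group Y" "A \<subseteq> Y"
  shows "derived (PG Y) A = generate (PG Y) (commutators A)"
proof -
  have b: "g \<in> A \<Longrightarrow> bij g" for g using assms perm_groupD(1) by blast
  have "g \<otimes>\<^bsub>PG Y\<^esub> h \<otimes>\<^bsub>PG Y\<^esub> inv\<^bsub>PG Y\<^esub> g \<otimes>\<^bsub>PG Y\<^esub> inv\<^bsub>PG Y\<^esub> h = g \<circ> h \<circ> finv g \<circ> finv h"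
    if "g \<in> A" "h \<in> A" for g h
    using that b assms(2) PG_inv[OF assms(1), of g] PG_inv[OF assms(1), of h]
    by (auto simp: PG_mult bij_comp bij_imp_bij_inv subset_iff)
  then have "derived_set (PG Y) A = commutators A"
    unfolding commutators_def by (auto; metis)
  then show ?thesis by (simp add: derived_def)
qed

lemma odd_card_sym_diff:
  assumes "finite A" "finite B"
  shows "odd (card {x. (x \<in> A) \<noteq> (x \<in> B)}) \<longleftrightarrow> (odd (card A) \<noteq> odd (card B))"
proof -
  have 1: "card A = card (A - B) + card (A \<inter> B)" "card B = card (B - A) + card (A \<inter> B)"
    using card_Diff_subset_Int[of A B] card_Diff_subset_Int[of B A] assms
      card_mono[of A "A \<inter> B"] card_mono[of B "A \<inter> B"] by (simp_all add: Int_commute)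
  have "{x. (x \<in> A) \<noteq> (x \<in> B)} = (A - B) \<union> (B - A)" by auto
  moreover have "card ((A - B) \<union> (B - A)) = card (A - B) + card (B - A)"
    using assms by (intro card_Un_disjoint) auto
  ultimately show ?thesis using 1 by auto
qed

section \<open>Distances and half-trees\<close>

text \<open>A condition on three consecutive vertices, unlike distinctness, can be checked locally
  when lists are cut and joined; acyclicity later turns it into a global statement.\<close>

fun nonback :: "'v list \<Rightarrow> bool" where
  "nonback (x # y # z # zs) \<longleftrightarrow> x \<noteq> z \<and> nonback (y # z # zs)"
| "nonback xs \<longleftrightarrow> True"

lemma nonback_Cons: "nonback (x # xs) \<Longrightarrow> nonback xs"
  by (cases xs rule: nonback.cases) auto

lemma nonback_appendD1: "nonback (xs @ ys) \<Longrightarrow> nonback xs"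
proof (induction xs rule: nonback.induct)
  case (1 x y z zs)
  then show ?case by auto
qed auto

lemma nonback_appendD2: "nonback (xs @ ys) \<Longrightarrow> nonback ys"
  by (induction xs) (auto dest: nonback_Cons)

locale colored_tree =
  fixes adj :: "'v \<Rightarrow> 'v \<Rightarrow> bool" and c :: "'v set \<Rightarrow> 'a::finite"
  assumes card3: "card (UNIV :: 'a set) \<ge> 3"
    and tree: "is_tree adj"
    and legal: "legal_coloring adj c"
begin

lemma adj_sym: "adj u v \<Longrightarrow> adj v u"
  and adj_irrefl: "\<not> adj v v"
  and walk_ex: "\<exists>xs. is_walk adj xs u v"
  and acyclic: "length xs \<ge> 4 \<Longrightarrow> successively adj xs \<Longrightarrow> hd xs = last xs \<Longrightarrow> \<not> distinct (butlast xs)"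
  using tree unfolding is_tree_def by blast+

section \<open>Reduced paths: existence and uniqueness\<close>

definition reduced :: "'v list \<Rightarrow> bool" where
  "reduced xs \<longleftrightarrow> successively adj xs \<and> nonback xs"

lemma reduced_sing [simp]: "reduced [x]"
  by (simp add: reduced_def)

lemma reduced_Cons_iff:
  "reduced (x # y # zs) \<longleftrightarrow> adj x y \<and> reduced (y # zs) \<and> (zs = [] \<or> x \<noteq> hd zs)"
  by (cases zs) (auto simp: reduced_def)

lemma reduced_sub: "reduced (as @ xs @ bs) \<Longrightarrow> reduced xs"
  unfolding reduced_def using nonback_appendD1[OF nonback_appendD2] by (auto simp: successively_append_iff)

text \<open>A closed reduced list of length at least 4 repeats a vertex by acyclicity, and the
  segment between the repetitions is a shorter closed reduced list. Lengths 2 and 3, about which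
  acyclicity is silent, are excluded by irreflexivity and by absence of backtracking.\<close>

lemma reduced_not_closed:
  assumes "reduced xs" "length xs \<ge> 2"
  shows "hd xs \<noteq> last xs"
  using assms
proof (induction "length xs" arbitrary: xs rule: less_induct)
  case less
  show ?case
  proof
    assume cl: "hd xs = last xs"
    have sx: "successively adj xs" using less by (simp add: reduced_def)
    have "length xs \<noteq> 2"
    proof
      assume "length xs = 2"
      then obtain x y where "xs = [x, y]"
        by (metis (no_types, lifting) One_nat_def Suc_1 length_0_conv length_Suc_conv)
      then show False using cl sx adj_irrefl by auto
    qed
    moreover have "length xs \<noteq> 3"
    proof
      assume "length xs = 3"
      then obtain x y z where "xs = [x, y, z]"
        by (auto simp: numeral_3_eq_3 length_Suc_conv)
      then show False using cl less.prems by (auto simp: reduced_def)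
    qed
    ultimately have "length xs \<ge> 4" using less.prems by linarith
    then have "\<not> distinct (butlast xs)" using acyclic sx cl by blast
    then obtain as y bs cs where d: "butlast xs = as @ [y] @ bs @ [y] @ cs"
      using not_distinct_decomp by blast
    have "xs \<noteq> []" using \<open>length xs \<ge> 4\<close> by auto
    then have e: "xs = as @ ([y] @ bs @ [y]) @ (cs @ [last xs])"
      using d append_butlast_last_id[of xs] by simp
    then have "reduced ([y] @ bs @ [y])" using less.prems(1) reduced_sub by metis
    moreover have "length ([y] @ bs @ [y]) < length xs" by (subst e) simp
    ultimately have "hd ([y] @ bs @ [y]) \<noteq> last ([y] @ bs @ [y])"
      by (intro less.hyps) auto
    then show False by simp
  qed
qed

lemma reduced_join:
  assumes "reduced (u # a # P)" "reduced (u # b # Q)" "a \<noteq> b"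
  shows "reduced (rev (a # P) @ u # b # Q)"
  using assms
proof (induction P arbitrary: u a b Q)
  case Nil
  then show ?case by (auto simp: reduced_Cons_iff dest: adj_sym)
next
  case (Cons p P)
  have "reduced (rev (p # P) @ a # u # b # Q)"
    by (rule Cons.IH) (use Cons.prems in \<open>auto simp: reduced_Cons_iff dest: adj_sym\<close>)
  then show ?case by simp
qed

definition is_path :: "'v \<Rightarrow> 'v list \<Rightarrow> 'v \<Rightarrow> bool" where
  "is_path x xs y \<longleftrightarrow> xs \<noteq> [] \<and> reduced xs \<and> hd xs = x \<and> last xs = y"

text \<open>Where two reduced paths to \<open>y\<close> part, reversing one and appending the other
  gives a closed reduced list.\<close>

lemma is_path_unique:
  assumes "is_path x P y" "is_path x Q y"
  shows "P = Q"
  using assms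
proof (induction P arbitrary: x Q)
  case Nil
  then show ?case by (simp add: is_path_def)
next
  case (Cons p P)
  have p: "p = x" using Cons.prems by (simp add: is_path_def)
  obtain Q' where Q: "Q = x # Q'" using Cons.prems by (cases Q) (auto simp: is_path_def)
  have closed: "R = []" if "reduced (x # R)" "last (x # R) = x" for R
  proof (rule ccontr)
    assume "R \<noteq> []"
    then have "length (x # R) \<ge> 2" by (cases R) auto
    with reduced_not_closed[OF that(1)] that(2) show False by simp
  qed
  show ?case
  proof (cases "P = [] \<or> Q' = []")
    case True
    have r: "reduced (x # P)" "reduced (x # Q')" "last (x # P) = y" "last (x # Q') = y"
      using Cons.prems p Q by (simp_all only: is_path_def)
    from True show ?thesis
    proof
      assume "P = []"
      then have "last (x # Q') = x" using r(3,4) by auto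
      then have "Q' = []" by (rule closed[OF r(2)])
      then show ?thesis using \<open>P = []\<close> p Q by simp
    next
      assume "Q' = []"
      then have "last (x # P) = x" using r(3,4) by auto
      then have "P = []" by (rule closed[OF r(1)])
      then show ?thesis using \<open>Q' = []\<close> p Q by simp
    qed
  next
    case False
    then obtain a P' b R where PQ: "P = a # P'" "Q' = b # R" by (meson list.exhaust)
    show ?thesis
    proof (cases "a = b")
      case True
      have "is_path a P y" "is_path a Q' y"
        using Cons.prems PQ True p Q by (auto simp: is_path_def reduced_Cons_iff)
      then show ?thesis using Cons.IH p Q by blast
    next
      case False
      have "reduced (rev (a # P') @ x # b # R)"
        by (rule reduced_join) (use Cons.prems PQ False p Q in \<open>auto simp: is_path_def\<close>)
      moreover have "hd (rev (a # P') @ x # b # R) = last (rev (a # P') @ x # b # R)"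
        using Cons.prems PQ p Q by (auto simp: is_path_def hd_append hd_rev)
      ultimately show ?thesis using reduced_not_closed by fastforce
    qed
  qed
qed

lemma is_path_step:
  assumes "adj u v" "is_path u P x"
  shows "(\<exists>R. P = u # v # R \<and> is_path v (v # R) x) \<or> is_path v (v # P) x \<and> \<not> (\<exists>R. P = u # v # R)"
proof (cases "\<exists>R. P = u # v # R")
  case True
  then obtain R where P: "P = u # v # R" by blast
  have "is_path v (v # R) x" using assms unfolding P by (simp add: is_path_def reduced_Cons_iff)
  then show ?thesis using P by blast
next
  case False
  obtain R where P: "P = u # R" using assms(2) by (cases P) (auto simp: is_path_def)
  have "R = [] \<or> v \<noteq> hd R" using False P by (metis list.collapse)
  then have "is_path v (v # P) x"
    using assms adj_sym[OF assms(1)] unfolding P by (simp add: is_path_def reduced_Cons_iff)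
  then show ?thesis using False by blast
qed

lemma is_path_ex: "\<exists>P. is_path x P y"
proof -
  have "is_walk adj xs x y \<Longrightarrow> \<exists>P. is_path x P y" for xs
  proof (induction xs arbitrary: x)
    case Nil
    then show ?case by (simp add: is_walk_def)
  next
    case (Cons z xs)
    show ?case
    proof (cases xs)
      case Nil
      then have "is_path x [x] y" using Cons.prems by (auto simp: is_walk_def is_path_def)
      then show ?thesis by blast
    next
      case (Cons w ws)
      then have "is_walk adj xs w y" "adj x w" using Cons.prems by (auto simp: is_walk_def)
      then show ?thesis using Cons.IH is_path_step adj_sym by blast
    qed
  qed
  then show ?thesis using walk_ex by blast
qed

section \<open>The path metric and half-trees\<close>

definition d :: "'v \<Rightarrow> 'v \<Rightarrow> nat" where
  "d x y = length (THE P. is_path x P y) - 1"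

lemma d_eq: "is_path x P y \<Longrightarrow> d x y = length P - 1"
  unfolding d_def using is_path_unique by (metis the_equality)

lemma d_self [simp]: "d x x = 0"
  using d_eq[of x "[x]" x] by (simp add: is_path_def)

lemma d_0_iff [simp]: "d x y = 0 \<longleftrightarrow> x = y"
proof
  assume "d x y = 0"
  moreover obtain P where P: "is_path x P y" using is_path_ex by blast
  ultimately have "length P = 1" using d_eq[OF P] by (cases P) (auto simp: is_path_def)
  then show "x = y" using P by (auto simp: is_path_def length_Suc_conv)
qed auto

lemma d_step:
  assumes "adj u v" "is_path u P x"
  shows "(\<exists>R. P = u # v # R) \<and> d u x = Suc (d v x) \<or> \<not> (\<exists>R. P = u # v # R) \<and> d v x = Suc (d u x)"
  using is_path_step[OF assms]
proof (elim disjE exE conjE)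
  fix R assume "P = u # v # R" "is_path v (v # R) x"
  then show ?thesis using d_eq[OF assms(2)] d_eq[of v "v # R" x] by simp
next
  assume "is_path v (v # P) x" "\<not> (\<exists>R. P = u # v # R)"
  moreover have "P \<noteq> []" using assms(2) by (simp add: is_path_def)
  ultimately show ?thesis using d_eq[OF assms(2)] d_eq[of v "v # P" x] by simp
qed

lemma d_adj: "adj u v \<Longrightarrow> d u x = Suc (d v x) \<or> d v x = Suc (d u x)"
  using is_path_ex[of u x] d_step[of u v _ x] by auto

lemma closer_ex: "u \<noteq> x \<Longrightarrow> \<exists>v. adj u v \<and> d u x = Suc (d v x)"
proof -
  assume n: "u \<noteq> x"
  obtain P where P: "is_path u P x" using is_path_ex by blast
  then obtain v R where "P = u # v # R" using n by (cases P rule: nonback.cases) (auto simp: is_path_def)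
  moreover from this have "adj u v"
    using P by (auto simp: is_path_def reduced_Cons_iff)
  ultimately show ?thesis using d_step[OF _ P] by blast
qed

text \<open>The tree property in metric form: the next vertex towards \<open>x\<close> is determined
  by the reduced path. Together with \<open>d_adj\<close> and \<open>closer_ex\<close> it replaces
  reduced paths from here on.\<close>

lemma closer_unique:
  assumes "adj u v" "adj u w" "d v x < d u x" "d w x < d u x"
  shows "v = w"
proof -
  obtain P where P: "is_path u P x" using is_path_ex by blast
  show ?thesis using d_step[OF assms(1) P] d_step[OF assms(2) P] assms(3,4) by auto
qed

lemma d_sym: "d x y = d y x"
proof -
  have "d y x \<le> d x y" for x y
  proof (induction "d x y" arbitrary: x)
    case 0
    then show ?case by simp
  next
    case (Suc n)
    then obtain z where z: "adj x z" "d x y = Suc (d z y)"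
      using closer_ex[of x y] by fastforce
    have zx: "d z x = 1" using z(1) d_adj[OF z(1), of x] by auto
    have "d w x \<le> Suc (d w z)" for w
    proof (induction "d w z" arbitrary: w)
      case 0
      then show ?case using zx by simp
    next
      case (Suc m)
      then obtain w' where w': "adj w w'" "d w z = Suc (d w' z)"
        using closer_ex[of w z] by fastforce
      then have "d w' x \<le> Suc (d w' z)" using Suc by auto
      then show ?case using d_adj[OF w'(1), of x] w' by auto
    qed
    from this[of y] Suc z show ?case by fastforce
  qed
  then show ?thesis by (simp add: le_antisym)
qed

lemma d_adj': "adj u v \<Longrightarrow> d x u = Suc (d x v) \<or> d x v = Suc (d x u)"
  using d_adj[of u v x] by (simp add: d_sym)

lemma connected_induct [consumes 0, case_names base step]:
  assumes "P r" and "\<And>x y. P x \<Longrightarrow> adj x y \<Longrightarrow> P y"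
  shows "P z"
proof (induction "d z r" arbitrary: z)
  case 0
  then show ?case using assms(1) by simp
next
  case (Suc n)
  then obtain w where "adj z w" "d z r = Suc (d w r)" using closer_ex[of z r] by fastforce
  then show ?case using Suc assms(2) adj_sym by (metis nat.inject)
qed

text \<open>For adjacent \<open>u\<close>, \<open>v\<close> this is the component of
  \<open>v\<close> after removal of their edge; the metric form makes its behaviour under
  automorphisms immediate.\<close>

definition T :: "'v \<Rightarrow> 'v \<Rightarrow> 'v set" where
  "T u v = {x. d x v < d x u}"

lemma T_in: "u \<noteq> v \<Longrightarrow> v \<in> T u v" and T_notin: "u \<notin> T u v"
  by (auto simp: T_def intro: gr0I)

lemma T_compl: "adj u v \<Longrightarrow> x \<in> T v u \<longleftrightarrow> x \<notin> T u v"
  using d_adj'[of u v x] by (auto simp: T_def)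

text \<open>If \<open>x\<close> were not \<open>v\<close>, its neighbour towards \<open>v\<close>
  would be nearer to \<open>u\<close> as well, and so is \<open>y\<close>. Uniqueness identifies the
  two, although \<open>y\<close> is farther from \<open>v\<close> than \<open>x\<close>.\<close>

lemma T_cross:
  assumes "adj u v" "x \<in> T u v" "y \<notin> T u v" "adj x y"
  shows "x = v \<and> y = u"
proof -
  have 1: "d x u = Suc (d x v)" "d y v = Suc (d y u)"
    using assms(2,3) d_adj'[OF assms(1), of x] d_adj'[OF assms(1), of y] by (auto simp: T_def)
  then have 2: "d y u = d x v" "d y v = Suc (d x v)"
    using d_adj[OF assms(4), of u] d_adj[OF assms(4), of v] by arith+
  have "x = v"
  proof (rule ccontr)
    assume "x \<noteq> v"
    then obtain z where z: "adj x z" "d x v = Suc (d z v)" using closer_ex by blast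
    have "d z u < d x u" using d_adj'[OF assms(1), of z] z 1 by linarith
    then have "z = y" using closer_unique[OF z(1) assms(4), of u] 1 2 by simp
    then show False using z(2) 2(2) by simp
  qed
  then show ?thesis using 2 by simp
qed

lemma T_step:
  assumes "adj u v" "adj v w" "w \<noteq> u"
  shows "T v w \<subseteq> T u v"
proof
  fix x assume "x \<in> T v w"
  then have "d w x < d v x" by (simp add: T_def d_sym)
  then have "\<not> d u x < d v x" using closer_unique[OF assms(2), of u x] assms adj_sym by blast
  then show "x \<in> T u v" using d_adj[OF assms(1), of x] by (auto simp: T_def d_sym)
qed

lemma T_sib_disj:
  assumes "adj v w" "adj v w'" "w \<noteq> w'"
  shows "T v w \<inter> T v w' = {}"
  using closer_unique[OF assms(1,2)] assms(3) by (auto simp: T_def d_sym)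

text \<open>The complement of \<open>T u v\<close> is connected and contains \<open>u\<close>; it
  could enter \<open>T p q\<close> only through \<open>p\<close>, which lies in
  \<open>T u v\<close>. Nesting is thus reduced to the position of two vertices.\<close>

lemma T_nest:
  assumes "adj u v" "adj p q" "p \<in> T u v" "u \<notin> T p q"
  shows "T p q \<subseteq> T u v"
proof -
  have "x \<notin> T u v \<Longrightarrow> x \<notin> T p q" for x
  proof (induction "d x u" arbitrary: x)
    case 0
    then show ?case using assms(4) by simp
  next
    case (Suc n)
    then obtain z where z: "adj x z" "d x u = Suc (d z u)" using closer_ex[of x u] by fastforce
    have "x \<noteq> u" using Suc by auto
    then have zT: "z \<notin> T u v" using T_cross[OF assms(1), of z x] Suc.prems adj_sym z by blast
    then have "z \<notin> T p q" using Suc z by auto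
    then show ?case using T_cross[OF assms(2), of x z] z zT assms(3) by blast
  qed
  then show ?thesis by blast
qed

end

section \<open>Local permutations\<close>

context colored_tree begin

lemma color_ex1: "\<exists>!u. adj v u \<and> c {v, u} = a"
proof -
  have b: "bij_betw c (edges_at adj v) UNIV" using legal by (simp add: legal_coloring_def)
  have e: "e \<in> edges_at adj v \<longleftrightarrow> (\<exists>u. adj v u \<and> e = {v, u})" for e
    unfolding edges_at_def edges_def by (auto dest: adj_sym)
  obtain e where "e \<in> edges_at adj v" "c e = a" using b by (metis UNIV_I bij_betw_imp_surj_on imageE)
  then obtain u where u: "adj v u" "c {v, u} = a" using e[of e] by auto
  show ?thesis
  proof (rule ex1I[of _ u])
    show "adj v u \<and> c {v, u} = a" using u by simp
    fix w assume w: "adj v w \<and> c {v, w} = a"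
    then have "{v, w} = {v, u}" using inj_onD[OF bij_betw_imp_inj_on[OF b], of "{v, w}" "{v, u}"] u e by auto
    then show "w = u" using w adj_irrefl by (auto simp: doubleton_eq_iff)
  qed
qed

definition nbr :: "'v \<Rightarrow> 'a \<Rightarrow> 'v" where
  "nbr v a = (THE u. adj v u \<and> c {v, u} = a)"

lemma nbr: "adj v (nbr v a)" "c {v, nbr v a} = a"
  using theI'[OF color_ex1[of v a]] unfolding nbr_def by auto

lemma color_inj: "adj v u \<Longrightarrow> adj v w \<Longrightarrow> c {v, u} = c {v, w} \<Longrightarrow> u = w"
  using color_ex1[of v "c {v, w}"] by blast

lemma nbr_color [simp]: "adj v u \<Longrightarrow> nbr v (c {v, u}) = u"
  using color_inj nbr by blast

text \<open>Here degree at least three enters. As \<open>c\<close> is total, \<open>a\<close> and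
  \<open>b\<close> may be arbitrary vertices, not only neighbours of \<open>v\<close>.\<close>

lemma third_nbr: "\<exists>w. adj v w \<and> w \<noteq> a \<and> w \<noteq> b"
proof -
  have "card {c {v, a}, c {v, b}} \<le> 2" by (simp add: card_insert_if)
  then have "{c {v, a}, c {v, b}} \<noteq> UNIV" using card3 by fastforce
  then obtain k where "k \<noteq> c {v, a}" "k \<noteq> c {v, b}" by blast
  then show ?thesis using nbr[of v k] by metis
qed

abbreviation lp :: "('v \<Rightarrow> 'v) \<Rightarrow> 'v \<Rightarrow> 'a \<Rightarrow> 'a" where
  "lp \<equiv> local_perm adj c"

lemma lp_app:
  assumes "adj v u"
  shows "lp g v (c {v, u}) = c {g v, g u}"
proof -
  have "inj_on c (edges_at adj v)" using legal by (simp add: legal_coloring_def bij_betw_def)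
  moreover have "{v, u} \<in> edges_at adj v" using assms by (auto simp: edges_at_def edges_def)
  ultimately have "the_inv_into (edges_at adj v) c (c {v, u}) = {v, u}" by (rule the_inv_into_f_f)
  then show ?thesis by (simp add: local_perm_def)
qed

lemma lp_eqI:
  assumes "\<And>u. adj v u \<Longrightarrow> f (c {v, u}) = c {g v, g u}"
  shows "lp g v = f"
proof
  fix a show "lp g v a = f a"
    using lp_app[OF nbr(1)[of v a], of g] assms[OF nbr(1)[of v a]] nbr(2)[of v a] by simp
qed

lemma autD: "g \<in> aut adj \<Longrightarrow> bij g" "g \<in> aut adj \<Longrightarrow> adj (g u) (g v) \<longleftrightarrow> adj u v"
  by (auto simp: aut_def)

lemma aut_inj: "g \<in> aut adj \<Longrightarrow> g x = g y \<longleftrightarrow> x = y"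
  using autD(1) bij_is_inj inj_eq by metis

lemma aut_finv: "g \<in> aut adj \<Longrightarrow> finv g (g x) = x" "g \<in> aut adj \<Longrightarrow> g (finv g x) = x"
  using autD(1) by (auto simp: bij_is_inj bij_is_surj surj_f_inv_f)

lemma perm_group_aut: "perm_group (aut adj)"
  unfolding perm_group_def
proof (intro conjI ballI)
  show "aut adj \<subseteq> {g. bij g}" "id \<in> aut adj" by (auto simp: aut_def)
  show "g \<circ> h \<in> aut adj" if "g \<in> aut adj" "h \<in> aut adj" for g h
    using that by (auto simp: aut_def bij_comp)
  show "finv g \<in> aut adj" if "g \<in> aut adj" for g
    using that autD(2)[OF that, of "finv g _" "finv g _"] aut_finv[OF that]
    by (auto simp: aut_def bij_imp_bij_inv)
qed

lemmas aut_id = perm_groupD(2)[OF perm_group_aut]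
  and aut_comp = perm_groupD(3)[OF perm_group_aut]
  and aut_inv = perm_groupD(4)[OF perm_group_aut]

lemma lp_comp:
  assumes "h \<in> aut adj"
  shows "lp (g \<circ> h) v = lp g (h v) \<circ> lp h v"
  using assms by (intro lp_eqI) (simp add: lp_app autD)

lemma lp_id: "lp id v = id"
  by (intro lp_eqI) simp

lemma lp_finv_comp:
  assumes "g \<in> aut adj"
  shows "lp (finv g) (g v) \<circ> lp g v = id"
proof -
  have "finv g \<circ> g = id" using autD(1)[OF assms] by (simp add: bij_is_inj)
  then show ?thesis using lp_comp[OF assms, of "finv g" v] lp_id by simp
qed

lemma lp_bij: assumes "g \<in> aut adj" shows "bij (lp g v)"
proof -
  have "inj (lp g v)" using lp_finv_comp[OF assms, of v] by (metis inj_on_id inj_on_imageI2)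
  then show ?thesis by (simp add: bij_def finite_UNIV_inj_surj)
qed

lemma lp_finv: assumes "g \<in> aut adj" shows "lp (finv g) (g v) = finv (lp g v)"
proof -
  have "lp (finv g) (g v) = lp (finv g) (g v) \<circ> (lp g v \<circ> finv (lp g v))"
    using surj_iff[THEN iffD1, OF bij_is_surj[OF lp_bij[OF assms]]] by simp
  also have "\<dots> = finv (lp g v)" by (simp add: comp_assoc[symmetric] lp_finv_comp[OF assms])
  finally show ?thesis .
qed

lemma aut_d: assumes "g \<in> aut adj" shows "d (g x) (g y) = d x y"
proof -
  have le: "d (h x) (h y) \<le> d x y" if h: "h \<in> aut adj" for h x y
  proof (induction "d x y" arbitrary: x)
    case 0
    then show ?case by simp
  next
    case (Suc n)
    then obtain z where z: "adj x z" "d x y = Suc (d z y)" using closer_ex[of x y] by fastforce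
    then have "d (h z) (h y) \<le> d z y" using Suc by auto
    moreover have "adj (h x) (h z)" using z(1) autD(2)[OF h] by simp
    ultimately show ?case using d_adj[of "h x" "h z" "h y"] z(2) by arith
  qed
  show ?thesis
    using le[OF assms, of x y] le[OF aut_inv[OF assms], of "g x" "g y"] aut_finv(1)[OF assms] by simp
qed

lemma aut_T: "g \<in> aut adj \<Longrightarrow> g x \<in> T (g u) (g v) \<longleftrightarrow> x \<in> T u v"
  by (simp add: T_def aut_d)

lemma aut_T_image: assumes "g \<in> aut adj" shows "g ` T u v = T (g u) (g v)"
proof
  show "T (g u) (g v) \<subseteq> g ` T u v"
  proof
    fix x assume "x \<in> T (g u) (g v)"
    then have "finv g x \<in> T u v" using aut_T[OF assms, of "finv g x" u v] aut_finv[OF assms] by simp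
    then show "x \<in> g ` T u v" using aut_finv(2)[OF assms, of x] by (metis imageI)
  qed
qed (use aut_T[OF assms] in auto)

text \<open>A map that is bijective on every star is a covering of the tree by itself, hence an
  isomorphism. Concretely, local injectivity prevents folding, so distances are preserved; local
  surjectivity and connectedness give surjectivity.\<close>

lemma local_iso:
  assumes s: "\<And>x. bij (s x)"
    and g: "\<And>x y. adj x y \<Longrightarrow> adj (g x) (g y) \<and> c {g x, g y} = s x (c {x, y})"
  shows "g \<in> aut adj" "lp g x = s x"
proof -
  have linj: "y = z" if "adj x y" "adj x z" "g y = g z" for x y z
  proof -
    have "s x (c {x, y}) = s x (c {x, z})" using g that by metis
    then have "c {x, y} = c {x, z}" using s by (metis bij_is_inj injD)
    then show ?thesis using color_inj that by blast
  qed
  have lsurj: "\<exists>y. adj x y \<and> g y = w" if "adj (g x) w" for x w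
  proof -
    obtain a where a: "s x a = c {g x, w}" using s by (metis bij_pointE)
    have "adj (g x) (g (nbr x a))" "c {g x, g (nbr x a)} = c {g x, w}"
      using g[OF nbr(1)] a nbr(2) by simp_all
    then show ?thesis using color_inj that nbr(1) by blast
  qed
  have gd: "d (g x) (g y) = d x y" for x y
  proof (induction "d x y" arbitrary: x rule: less_induct)
    case less
    show ?case
    proof (cases "x = y")
      case False
      then obtain z where z: "adj x z" "d x y = Suc (d z y)" using closer_ex by blast
      then have gz: "d (g z) (g y) = d z y" using less by simp
      have a: "adj (g x) (g z)" using g z by blast
      show ?thesis
      proof (rule ccontr)
        assume n: "d (g x) (g y) \<noteq> d x y"
        then have lt: "d (g z) (g y) = Suc (d (g x) (g y))" using d_adj[OF a, of "g y"] gz z by arith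
        then have "z \<noteq> y" by auto
        then obtain z' where z': "adj z z'" "d z y = Suc (d z' y)" using closer_ex by blast
        then have gz': "d (g z') (g y) = d z' y" using less z by simp
        \<comment> \<open>If the image folds at \<open>g z\<close>, then both \<open>g x\<close> and
          \<open>g z'\<close> are the neighbour of \<open>g z\<close> nearer to
          \<open>g y\<close>.\<close>
        have "g z' = g x"
          using closer_unique[of "g z" "g z'" "g x" "g y"] a adj_sym g[OF z'(1)] gz gz' z' lt by simp
        then have "z' = x" using linj z z' adj_sym by blast
        then show False using z z' by simp
      qed
    qed simp
  qed
  have "inj g" by (rule injI) (metis gd d_0_iff)
  moreover have "w \<in> range g" for w
    by (induction w rule: connected_induct[where r = "g undefined"]) (use lsurj in blast)+
  ultimately have b: "bij g" by (auto simp: bij_def)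
  have "adj x y" if "adj (g x) (g y)" for x y
    using lsurj[OF that] \<open>inj g\<close> by (metis injD)
  then show "g \<in> aut adj" using b g unfolding aut_def by blast
  show "lp g x = s x" by (rule lp_eqI) (use g in simp)
qed

section \<open>Automorphisms with prescribed local permutations\<close>

definition par :: "'v \<Rightarrow> 'v \<Rightarrow> 'v" where
  "par r x = (SOME y. adj x y \<and> d x r = Suc (d y r))"

lemma par: assumes "x \<noteq> r" shows "adj x (par r x)" "d x r = Suc (d (par r x) r)"
  using someI_ex[OF closer_ex[OF assms]] unfolding par_def by auto

lemma par_eq: assumes "adj x y" "d y r < d x r" shows "par r x = y"
proof -
  have n: "x \<noteq> r" using assms(2) by auto
  show ?thesis by (rule closer_unique[OF par(1)[OF n] assms(1), of r]) (use par(2)[OF n] assms(2) in simp_all)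
qed

text \<open>Passing to the parent is no structural recursion, so a counter is added; it is started
  at the distance of \<open>x\<close> from \<open>r\<close>.\<close>

primrec ext_step :: "('v \<Rightarrow> 'a \<Rightarrow> 'a) \<Rightarrow> 'v \<Rightarrow> 'v \<Rightarrow> nat \<Rightarrow> 'v \<Rightarrow> 'v" where
  "ext_step s r w 0 x = w"
| "ext_step s r w (Suc n) x = nbr (ext_step s r w n (par r x)) (s (par r x) (c {par r x, x}))"

text \<open>The two ends of an edge must assign its colour the same image. A tree has no cycles that
  would impose further conditions, so the automorphism is built outwards from the freely chosen
  image of \<open>r\<close>.\<close>

lemma extension_ex:
  assumes s: "\<And>x. bij (s x)"
    and compat: "\<And>x y. adj x y \<Longrightarrow> s x (c {x, y}) = s y (c {x, y})"
  shows "\<exists>g\<in>aut adj. g r = w \<and> (\<forall>x. lp g x = s x)"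
proof -
  define g where "g x = ext_step s r w (d x r) x" for x
  have step: "adj (g x) (g y) \<and> c {g x, g y} = s x (c {x, y})" if "adj x y" "d y r = Suc (d x r)" for x y
  proof -
    have "par r y = x" using par_eq[of y x r] that adj_sym by simp
    then have "g y = nbr (g x) (s x (c {x, y}))" using that by (simp add: g_def)
    then show ?thesis using nbr by simp
  qed
  have "adj (g x) (g y) \<and> c {g x, g y} = s x (c {x, y})" if "adj x y" for x y
  proof (cases "d y r = Suc (d x r)")
    case True
    then show ?thesis using step that by blast
  next
    case False
    then have "d x r = Suc (d y r)" using d_adj[OF that, of r] by simp
    then show ?thesis using step[OF adj_sym[OF that]] adj_sym compat[OF that] by (simp add: insert_commute)
  qed
  then have "g \<in> aut adj \<and> (\<forall>x. lp g x = s x)" using local_iso[where g = g and s = s, OF s] by blast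
  moreover have "g r = w" by (simp add: g_def)
  ultimately show ?thesis by blast
qed

lemma extension_const:
  assumes "bij f"
  shows "\<exists>g\<in>aut adj. g r = w \<and> (\<forall>x. lp g x = f)"
  using extension_ex[of "\<lambda>_. f"] assms by blast

lemma extension_local:
  assumes t: "bij t" and F: "\<And>f. f \<in> F \<Longrightarrow> bij f" and ex: "\<And>a. \<exists>f\<in>F. f a = t a"
  shows "\<exists>g\<in>aut adj. g r = r \<and> lp g r = t \<and> (\<forall>x. x \<noteq> r \<longrightarrow> lp g x \<in> F)"
proof -
  obtain \<phi> where \<phi>: "\<And>a. \<phi> a \<in> F" "\<And>a. \<phi> a a = t a" using ex by metis
  \<comment> \<open>\<open>par x r\<close> is the neighbour of \<open>r\<close> towards
    \<open>x\<close>. Each branch at \<open>r\<close> thus gets one constant permutation, and it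
    agrees with \<open>t\<close> on the colour of the edge leading into the branch.\<close>
  define s where "s x = (if x = r then t else \<phi> (c {r, par x r}))" for x
  have "\<exists>g\<in>aut adj. g r = r \<and> (\<forall>x. lp g x = s x)"
  proof (rule extension_ex)
    show "bij (s x)" for x using t F \<phi> by (simp add: s_def)
    have root: "s r (c {r, y}) = s y (c {r, y})" if "adj r y" for y
    proof -
      have "y \<noteq> r" using that adj_irrefl by blast
      moreover have "par y r = y" by (rule par_eq[OF that]) (use that adj_irrefl in \<open>auto intro: gr0I\<close>)
      ultimately show ?thesis by (simp add: s_def \<phi>)
    qed
    show "s x (c {x, y}) = s y (c {x, y})" if a: "adj x y" for x y
    proof (cases "x = r \<or> y = r")
      case True
      then show ?thesis using root[of x] root[of y] a adj_sym by (metis insert_commute)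
    next
      case False
      define q where "q = par x r"
      have q: "adj r q" "d r x = Suc (d q x)" using par[of r x] False by (auto simp: q_def)
      have "x \<in> T r q" using q by (simp add: T_def d_sym)
      then have "y \<in> T r q" using T_cross[OF q(1) _ _ a] False by blast
      then have "par y r = q" by (intro par_eq[OF q(1)]) (simp add: T_def d_sym)
      then show ?thesis using False by (simp add: s_def q_def)
    qed
  qed
  then show ?thesis using \<phi>(1) by (force simp: s_def)
qed

text \<open>Tits' independence property: the only edge between the two sides is fixed pointwise by
  \<open>g\<close>, so the identity on one side and \<open>g\<close> on the other are
  compatible.\<close>

lemma edge_independence:
  assumes g: "g \<in> aut adj" and uv: "adj u v" "g u = u" "g v = v"
  defines "f \<equiv> \<lambda>x. if x \<in> T u v then x else g x"
  shows "f \<in> aut adj" "lp f x = (if x \<in> T u v then id else lp g x)"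
proof -
  define s where "s x = (if x \<in> T u v then id else lp g x)" for x
  have b: "bij (s x)" for x using lp_bij[OF g] by (simp add: s_def)
  have a: "adj (f x) (f y) \<and> c {f x, f y} = s x (c {x, y})" if "adj x y" for x y
  proof -
    have "y = u \<and> x = v \<or> y = v \<and> x = u" if "x \<in> T u v \<longleftrightarrow> y \<notin> T u v"
      using T_cross[OF uv(1)] \<open>adj x y\<close> adj_sym that by blast
    then have "(f x = x \<and> f y = y \<and> x \<in> T u v) \<or> (f x = g x \<and> f y = g y \<and> x \<notin> T u v)"
      using uv by (auto simp: f_def)
    then show ?thesis using that lp_app[OF that] autD(2)[OF g] by (auto simp: s_def)
  qed
  show "f \<in> aut adj" "lp f x = (if x \<in> T u v then id else lp g x)"
    using local_iso[OF b a] by (simp_all add: s_def)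
qed

text \<open>The base vertex is arbitrary; what matters is whether two vertices have equal
  type.\<close>

definition tp :: "'v \<Rightarrow> bool" where
  "tp x \<longleftrightarrow> even (d x undefined)"

lemma tp_adj: "adj x y \<Longrightarrow> tp y \<longleftrightarrow> \<not> tp x"
  using d_adj[of x y undefined] by (auto simp: tp_def)

lemma walk_parity: "is_walk adj xs u v \<Longrightarrow> even (length xs - 1) \<longleftrightarrow> tp u = tp v"
proof (induction xs arbitrary: u)
  case Nil
  then show ?case by (simp add: is_walk_def)
next
  case (Cons x xs)
  show ?case
  proof (cases xs)
    case Nil
    then show ?thesis using Cons.prems by (auto simp: is_walk_def)
  next
    case (Cons y ys)
    then have w: "is_walk adj xs y v" "adj u y" using Cons.prems by (auto simp: is_walk_def)
    then show ?thesis using Cons.IH[OF w(1)] tp_adj[OF w(2)] Cons by auto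
  qed
qed

lemma type_pres_eq: "type_pres adj H = {g \<in> H. \<forall>v. tp (g v) = tp v}"
  using walk_ex walk_parity unfolding type_pres_def by blast

lemma aut_tp: assumes "g \<in> aut adj" shows "(tp (g v) = tp v) = (tp (g w) = tp w)"
  by (induction w rule: connected_induct[where r = v])
    (use assms in \<open>auto dest: tp_adj simp: tp_adj[of "g _" "g _"] autD\<close>)

lemma d_even_tp: "tp x = tp y \<longleftrightarrow> even (d x y)"
proof (induction "d x y" arbitrary: x)
  case 0
  then show ?case by simp
next
  case (Suc n)
  then obtain z where z: "adj x z" "d x y = Suc (d z y)" using closer_ex[of x y] by fastforce
  then have "tp z = tp y \<longleftrightarrow> even (d z y)" using Suc by auto
  then show ?case using tp_adj[OF z(1)] z(2) by auto
qed

end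

section \<open>The groups G(F,F') and displaced half-trees\<close>

context colored_tree begin

lemma G2_iff: "g \<in> G2_grp adj c F F' \<longleftrightarrow> g \<in> aut adj \<and> finite {v. lp g v \<notin> F} \<and> (\<forall>v. lp g v \<in> F')"
  by (auto simp: G2_grp_def G_grp_def U_grp_def)

lemma perm_group_G2:
  assumes F: "perm_group F" and F': "perm_group F'"
  shows "perm_group (G2_grp adj c F F')"
  unfolding perm_group_def
proof (intro conjI ballI)
  show "G2_grp adj c F F' \<subseteq> {g. bij g}" using autD(1) by (auto simp: G2_iff)
  show "id \<in> G2_grp adj c F F'"
    using perm_groupD(2)[OF F] perm_groupD(2)[OF F'] aut_id by (simp add: G2_iff lp_id)
  show "g \<circ> h \<in> G2_grp adj c F F'" if "g \<in> G2_grp adj c F F'" "h \<in> G2_grp adj c F F'" for g h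
  proof -
    have a: "g \<in> aut adj" "h \<in> aut adj" using that by (auto simp: G2_iff)
    have "{v. lp (g \<circ> h) v \<notin> F} \<subseteq> h -` {v. lp g v \<notin> F} \<union> {v. lp h v \<notin> F}"
      using perm_groupD(3)[OF F] by (auto simp: lp_comp[OF a(2)])
    moreover have "finite (h -` {v. lp g v \<notin> F} \<union> {v. lp h v \<notin> F})"
      by (intro finite_UnI finite_vimageI bij_is_inj autD(1) a) (use that in \<open>simp_all add: G2_iff\<close>)
    ultimately have "finite {v. lp (g \<circ> h) v \<notin> F}" using finite_subset by blast
    then show ?thesis using that perm_groupD(3)[OF F'] aut_comp[OF a]
      by (auto simp: G2_iff lp_comp)
  qed
  show "finv g \<in> G2_grp adj c F F'" if "g \<in> G2_grp adj c F F'" for g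
  proof -
    have a: "g \<in> aut adj" using that by (auto simp: G2_iff)
    have l: "lp (finv g) v = finv (lp g (finv g v))" for v
      using lp_finv[OF a, of "finv g v"] aut_finv(2)[OF a] by simp
    have "{v. lp (finv g) v \<notin> F} \<subseteq> g ` {v. lp g v \<notin> F}"
    proof
      fix v assume "v \<in> {v. lp (finv g) v \<notin> F}"
      then have "lp g (finv g v) \<notin> F" using l perm_groupD(4)[OF F] by auto
      then show "v \<in> g ` {v. lp g v \<notin> F}" using aut_finv(2)[OF a, of v] by (intro image_eqI[of _ _ "finv g v"]) auto
    qed
    then have "finite {v. lp (finv g) v \<notin> F}" using that finite_subset by (fastforce simp: G2_iff)
    then show ?thesis using that perm_groupD(4)[OF F'] aut_inv[OF a] by (auto simp: G2_iff l)
  qed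
qed

lemma perm_group_type_pres:
  assumes "perm_group H"
  shows "perm_group (type_pres adj H)"
  unfolding perm_group_def type_pres_eq
proof (intro conjI ballI)
  show "finv g \<in> {g \<in> H. \<forall>v. tp (g v) = tp v}" if "g \<in> {g \<in> H. \<forall>v. tp (g v) = tp v}" for g
  proof -
    have "g (finv g v) = v" for v using that perm_groupD(1)[OF assms] by (simp add: bij_is_surj surj_f_inv_f)
    then have "tp (finv g v) = tp v" for v using that by (metis (mono_tags, lifting) mem_Collect_eq)
    then show ?thesis using that perm_groupD(4)[OF assms] by simp
  qed
qed (use perm_groupD[OF assms] in auto)

lemma aut_tp_pres: "g \<in> aut adj \<Longrightarrow> tp (g v) = tp v \<Longrightarrow> tp (g w) = tp w"
  using aut_tp by blast

text \<open>Beyond \<open>q\<close> there are two disjoint half-trees inside \<open>T p q\<close>;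
  one of them contains fewer points of \<open>A\<close>.\<close>

lemma deep_half_tree:
  assumes "finite A" "adj p q"
  shows "\<exists>p' q'. adj p' q' \<and> T p' q' \<subseteq> T p q \<and> T p' q' \<inter> A = {}"
  using assms(2)
proof (induction "card (A \<inter> T p q)" arbitrary: p q rule: less_induct)
  case less
  show ?case
  proof (cases "T p q \<inter> A = {}")
    case True
    then show ?thesis using less.prems by blast
  next
    case False
    then have pos: "card (A \<inter> T p q) > 0" using assms(1) by (simp add: card_gt_0_iff Int_commute)
    obtain r where r: "adj q r" "r \<noteq> p" using third_nbr by blast
    obtain s where s: "adj q s" "s \<noteq> p" "s \<noteq> r" using third_nbr by blast
    have sub: "T q r \<subseteq> T p q" "T q s \<subseteq> T p q" using T_step[OF less.prems] r s by auto
    have "T q r \<inter> T q s = {}" using T_sib_disj r s by blast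
    then have "card (A \<inter> T q r) + card (A \<inter> T q s) = card ((A \<inter> T q r) \<union> (A \<inter> T q s))"
      using assms(1) by (intro card_Un_disjoint[symmetric]) auto
    also have "\<dots> \<le> card (A \<inter> T p q)" using sub assms(1) by (intro card_mono) auto
    finally have "card (A \<inter> T q r) < card (A \<inter> T p q) \<or> card (A \<inter> T q s) < card (A \<inter> T p q)"
      using pos by arith
    then show ?thesis using less.hyps r(1) s(1) sub by (meson subset_trans)
  qed
qed

text \<open>At a moved vertex \<open>p\<close> a direction is needed that neither points to
  \<open>h p\<close> nor is mapped to the direction from \<open>h p\<close> back to
  \<open>p\<close>. Degree three leaves one, and the two half-trees then point away from each
  other.\<close>

lemma displaced_half_tree:
  assumes h: "h \<in> aut adj" "h \<noteq> id"
  shows "\<exists>p q. adj p q \<and> T p q \<inter> T (h p) (h q) = {}"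
proof -
  obtain p where p: "h p \<noteq> p" using h(2) by (auto simp: fun_eq_iff)
  define x where "x = par (h p) p"
  \<comment> \<open>\<open>h y\<close> is the neighbour of \<open>h p\<close> towards
    \<open>p\<close>, so avoiding \<open>y\<close> keeps \<open>h q\<close> from pointing
    back.\<close>
  define y where "y = finv h (par p (h p))"
  have x: "adj p x" "d p (h p) = Suc (d x (h p))" using par[of p "h p"] p by (auto simp: x_def)
  have y: "h y = par p (h p)" using aut_finv(2)[OF h(1)] by (simp add: y_def)
  then have y': "adj (h p) (h y)" "d (h p) p = Suc (d (h y) p)" using par[of "h p" p] p by auto
  obtain q where q: "adj p q" "q \<noteq> x" "q \<noteq> y" using third_nbr by blast
  have hq: "adj (h p) (h q)" "h q \<noteq> h y" using q autD(2)[OF h(1)] aut_inj[OF h(1)] by auto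
  have 1: "h p \<notin> T p q" using closer_unique[OF x(1) q(1), of "h p"] x q by (auto simp: T_def d_sym)
  have 2: "p \<notin> T (h p) (h q)" using closer_unique[OF y'(1) hq(1), of p] y' hq by (auto simp: T_def d_sym)
  have 3: "q \<notin> T (h p) (h q)"
    using T_cross[OF hq(1) _ 2 adj_sym[OF q(1)]] p by auto
  have "T (h p) (h q) \<subseteq> T q p"
    by (rule T_nest[OF adj_sym[OF q(1)] hq(1) _ 3]) (use 1 T_compl[OF q(1)] in blast)
  then show ?thesis using q(1) T_compl[OF q(1)] by blast
qed

text \<open>Supported elements are available only behind edges whose colour is fixed by a given
  permutation, hence the prescribed colour \<open>a\<close>. If the edge found has another colour,
  one step further along \<open>a\<close> suffices.\<close>

lemma displaced_colored_half_tree: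
  assumes h: "h \<in> aut adj" "h \<noteq> id" and "finite A"
  shows "\<exists>v. T (nbr v a) v \<inter> h ` T (nbr v a) v = {} \<and> T (nbr v a) v \<inter> A = {}"
proof -
  obtain p q where pq: "adj p q" "T p q \<inter> T (h p) (h q) = {}" using displaced_half_tree[OF h] by blast
  obtain p' q' where pq': "adj p' q'" "T p' q' \<subseteq> T p q" "T p' q' \<inter> A = {}"
    using deep_half_tree[OF \<open>finite A\<close> pq(1)] by blast
  have "\<exists>v. T (nbr v a) v \<subseteq> T p' q'"
  proof (cases "c {p', q'} = a")
    case True
    then have "nbr q' a = p'" using nbr_color[OF adj_sym[OF pq'(1)]] by (simp add: insert_commute)
    then show ?thesis by (intro exI[of _ q']) simp
  next
    case False
    define v where "v = nbr q' a"
    have v: "adj q' v" "c {q', v} = a" using nbr by (auto simp: v_def)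
    have "nbr v a = q'" using nbr_color[OF adj_sym[OF v(1)]] v(2) by (simp add: insert_commute)
    moreover have "v \<noteq> p'" using False v by (auto simp: insert_commute)
    ultimately show ?thesis using T_step[OF pq'(1) v(1)] by (intro exI[of _ v]) simp
  qed
  then obtain v where v: "T (nbr v a) v \<subseteq> T p' q'" by blast
  then have "h ` T (nbr v a) v \<subseteq> T (h p) (h q)"
    using pq' aut_T_image[OF h(1), of p q] by blast
  then show ?thesis using v pq pq' by (intro exI[of _ v]) blast
qed

text \<open>The conjugate of \<open>x\<close> by \<open>h\<close> is supported on the image of
  \<open>B\<close>, so it cannot agree with \<open>x\<close> at a point that \<open>x\<close>
  moves.\<close>

lemma comm_ne_id:
  assumes h: "h \<in> aut adj" and x: "x \<in> aut adj" "x \<noteq> id" "\<And>z. z \<notin> B \<Longrightarrow> x z = z"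
    and B: "B \<inter> h ` B = {}"
  shows "h \<circ> x \<circ> finv h \<circ> finv x \<noteq> id"
proof
  assume e: "h \<circ> x \<circ> finv h \<circ> finv x = id"
  obtain z where z: "x z \<noteq> z" using x(2) by (auto simp: fun_eq_iff)
  have "h (x (finv h z)) = x z" using fun_cong[OF e, of "x z"] aut_finv(1)[OF x(1)] by simp
  moreover have "finv h z \<notin> B" using B x(3)[of z] z aut_finv(2)[OF h, of z] by (metis disjoint_iff image_eqI)
  ultimately show False using x(3)[of "finv h z"] z aut_finv(2)[OF h, of z] by simp
qed

end

section \<open>The parity kernel\<close>

text \<open>\<open>F\<close>, \<open>F2\<close>, \<open>F1\<close> are the groups \<open>F \<le> F'' \<le> F'\<close> of the statement.\<close>

locale index_two_data = colored_tree adj c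
  for adj :: "'v \<Rightarrow> 'v \<Rightarrow> bool" and c :: "'v set \<Rightarrow> 'a::finite" +
  fixes F F2 F1 :: "('a \<Rightarrow> 'a) set"
  assumes F: "perm_group F" and F2: "perm_group F2" and F1: "perm_group F1"
    and sub: "F \<subseteq> F2" "F2 \<subseteq> F1" "F1 \<subseteq> hat F"
    and idx: "index (PG F1) F2 = 2"
    and simple: "simple_abs (PG (type_pres adj (G2_grp adj c F F2)))"
begin

lemma F1D: "t \<in> F1 \<Longrightarrow> bij t" "t \<in> F1 \<Longrightarrow> \<exists>f\<in>F. f a = t a"
  using sub(3) by (auto simp: hat_def)

lemma F2_xor:
  assumes "f \<in> F1" "g \<in> F1"
  shows "f \<circ> g \<in> F2 \<longleftrightarrow> (f \<in> F2 \<longleftrightarrow> g \<in> F2)"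
proof -
  have b: "bij f" "bij g" using assms F1D by auto
  have 1: "g \<in> F2" if "f \<circ> g \<in> F2" "f \<in> F2"
  proof -
    have "finv f \<circ> (f \<circ> g) \<in> F2" using perm_groupD(3,4)[OF F2] that by blast
    then show ?thesis using b by (simp add: comp_assoc[symmetric] bij_is_inj)
  qed
  have 2: "f \<in> F2" if "f \<circ> g \<in> F2" "g \<in> F2"
  proof -
    have "(f \<circ> g) \<circ> finv g \<in> F2" using perm_groupD(3,4)[OF F2] that by blast
    moreover have "g \<circ> finv g = id" using b bij_is_surj surj_iff by blast
    ultimately show ?thesis by (simp add: comp_assoc)
  qed
  show ?thesis
    using 1 2 perm_groupD(3)[OF F2] index_two(2)[OF F1 F2 sub(2) idx, of g f] assms by blast
qed

abbreviation "G \<equiv> G2_grp adj c F F1"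
abbreviation "Gt \<equiv> type_pres adj G"
abbreviation "S \<equiv> type_pres adj (G2_grp adj c F F2)"

lemma groups: "perm_group G" "perm_group Gt" "perm_group S"
  using perm_group_G2 perm_group_type_pres F F1 F2 by auto

lemma G_aut: "g \<in> G \<Longrightarrow> g \<in> aut adj"
  by (simp add: G2_iff)

lemma Gt_iff: "g \<in> Gt \<longleftrightarrow> g \<in> G \<and> (\<forall>v. tp (g v) = tp v)"
  by (simp add: type_pres_eq)

lemma Gt_aut: "g \<in> Gt \<Longrightarrow> g \<in> aut adj"
  by (simp add: Gt_iff G_aut)

section \<open>Singular vertices and their parities\<close>

definition sing :: "('v \<Rightarrow> 'v) \<Rightarrow> 'v set" where
  "sing g = {v. lp g v \<notin> F2}"

lemma sing_finite: "g \<in> G \<Longrightarrow> finite (sing g)"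
  unfolding sing_def G2_iff using sub(1) by (auto elim!: rev_finite_subset)

lemma S_iff: "g \<in> S \<longleftrightarrow> g \<in> Gt \<and> sing g = {}"
  using sub(2) by (auto simp: type_pres_eq G2_iff sing_def)

lemma sing_comp: "g \<in> G \<Longrightarrow> h \<in> G \<Longrightarrow> x \<in> sing (g \<circ> h) \<longleftrightarrow> (h x \<in> sing g) \<noteq> (x \<in> sing h)"
  using F2_xor[of "lp g (h x)" "lp h x"] by (auto simp: sing_def G2_iff lp_comp)

lemma sing_id: "sing id = {}"
  using perm_groupD(2)[OF F2] by (simp add: sing_def lp_id)

lemma sing_finv: assumes "g \<in> G" shows "g x \<in> sing (finv g) \<longleftrightarrow> x \<in> sing g"
proof -
  have "finv g \<circ> g = id" using autD(1)[OF G_aut[OF assms]] by (simp add: bij_is_inj)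
  then show ?thesis using sing_comp[OF perm_groupD(4)[OF groups(1) assms] assms, of x] sing_id by auto
qed

lemma fix_tp: "g \<in> aut adj \<Longrightarrow> g v = v \<Longrightarrow> tp (g w) = tp w"
  using aut_tp[of g v w] by simp

lemma translation:
  "\<exists>s\<in>G. s v = w \<and> (\<forall>x. lp s x = id)"
proof -
  obtain g where g: "g \<in> aut adj" "g v = w" "\<And>x. lp g x = id"
    using extension_const[of id v w] by auto
  then show ?thesis using perm_groupD(2)[OF F] perm_groupD(2)[OF F1] by (intro bexI[of _ g]) (auto simp: G2_iff)
qed

lemma S_transitive:
  assumes "tp v = tp w"
  shows "\<exists>s\<in>S. s v = w \<and> (\<forall>x. lp s x = id)"
proof -
  obtain s where s: "s \<in> G" "s v = w" "\<And>x. lp s x = id" using translation by blast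
  have "tp (s x) = tp x" for x using aut_tp[OF G_aut[OF s(1)], of v x] s(2) assms by simp
  then have "s \<in> S" using s perm_groupD(2)[OF F2] by (simp add: S_iff Gt_iff sing_def)
  then show ?thesis using s by blast
qed

text \<open>An element of \<open>F1\<close> outside \<open>F2\<close> is placed at \<open>v\<close>,
  with values in \<open>F\<close> elsewhere; since \<open>v\<close> is fixed, types are preserved.
  These elements realise odd parities and cancel singular vertices.\<close>

lemma one_singularity: "\<exists>m\<in>Gt. sing m = {v}"
proof -
  obtain t where t: "t \<in> F1" "t \<notin> F2" using index_two(1)[OF F1 F2 sub(2) idx] by blast
  obtain g where g: "g \<in> aut adj" "g v = v" "lp g v = t" "\<And>x. x \<noteq> v \<Longrightarrow> lp g x \<in> F"
    using extension_local[of t F v] F1D[OF t(1)] perm_groupD(1)[OF F] by blast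
  have "{x. lp g x \<notin> F} \<subseteq> {v}" using g(4) by blast
  then have "finite {x. lp g x \<notin> F}" using finite_subset by blast
  moreover have "lp g x \<in> F1" for x using g t sub by (cases "x = v") auto
  ultimately have "g \<in> G" using g(1) by (simp add: G2_iff)
  then have "g \<in> Gt" using fix_tp[OF g(1,2)] by (simp add: Gt_iff)
  moreover have "sing g = {v}" using g t sub by (auto simp: sing_def)
  ultimately show ?thesis by blast
qed

definition odd_sing :: "('v \<Rightarrow> 'v) \<Rightarrow> bool \<Rightarrow> bool" where
  "odd_sing g b \<longleftrightarrow> odd (card {v \<in> sing g. tp v = b})"

text \<open>The second type \<open>b'\<close> admits an \<open>h\<close> that exchanges types:
  singular vertices of \<open>g\<close> are pulled back along \<open>h\<close>.\<close>

lemma odd_sing_comp: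
  assumes "g \<in> G" "h \<in> G" and b': "\<And>x. tp x = b \<longleftrightarrow> tp (h x) = b'"
  shows "odd_sing (g \<circ> h) b \<longleftrightarrow> (odd_sing g b' \<noteq> odd_sing h b)"
proof -
  have h: "bij h" using autD(1)[OF G_aut[OF assms(2)]] .
  have "{v \<in> sing (g \<circ> h). tp v = b}
      = {v. (v \<in> h -` {v \<in> sing g. tp v = b'}) \<noteq> (v \<in> {v \<in> sing h. tp v = b})}"
    using b' by (auto simp: sing_comp[OF assms(1,2)])
  moreover have "card (h -` {v \<in> sing g. tp v = b'}) = card {v \<in> sing g. tp v = b'}"
    using h by (intro card_vimage_inj) (auto simp: bij_is_inj bij_is_surj)
  moreover have "finite (h -` {v \<in> sing g. tp v = b'})"
    using h sing_finite[OF assms(1)] by (intro finite_vimageI) (auto simp: bij_is_inj)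
  ultimately show ?thesis
    using odd_card_sym_diff[of "h -` {v \<in> sing g. tp v = b'}" "{v \<in> sing h. tp v = b}"]
      sing_finite[OF assms(2)] by (simp add: odd_sing_def)
qed

lemma odd_sing_comp_Gt:
  assumes "g \<in> G" "h \<in> Gt"
  shows "odd_sing (g \<circ> h) b \<longleftrightarrow> (odd_sing g b \<noteq> odd_sing h b)"
  using odd_sing_comp[of g h b b] assms by (simp add: Gt_iff)

lemma odd_sing_empty: "sing g = {} \<Longrightarrow> \<not> odd_sing g b"
  by (simp add: odd_sing_def)

lemma odd_sing_single: "sing g = {x} \<Longrightarrow> odd_sing g b \<longleftrightarrow> tp x = b"
proof -
  assume "sing g = {x}"
  then have "{v \<in> sing g. tp v = b} = (if tp x = b then {x} else {})" by auto
  then show ?thesis by (simp add: odd_sing_def)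
qed

lemma odd_sing_finv:
  assumes "g \<in> Gt"
  shows "odd_sing (finv g) b \<longleftrightarrow> odd_sing g b"
proof -
  have "finv g \<circ> g = id" using autD(1)[OF Gt_aut[OF assms]] by (simp add: bij_is_inj)
  moreover have "finv g \<in> G" using perm_groupD(4)[OF groups(2) assms] Gt_iff by blast
  ultimately show ?thesis
    using odd_sing_comp_Gt[of "finv g" g b] assms odd_sing_empty[OF sing_id, of b] by simp
qed

definition Ker :: "('v \<Rightarrow> 'v) set" where
  "Ker = {g \<in> Gt. \<forall>b. \<not> odd_sing g b}"

lemma Gt_G: "g \<in> Gt \<Longrightarrow> g \<in> G" by (simp add: Gt_iff)

lemma perm_group_Ker: "perm_group Ker"
  unfolding perm_group_def Ker_def
  using perm_groupD[OF groups(2)] odd_sing_comp_Gt Gt_G odd_sing_finv odd_sing_empty[OF sing_id] by auto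

lemma S_Ker: "S \<subseteq> Ker"
  by (auto simp: S_iff Ker_def odd_sing_empty)

lemma Ker_Gt: "Ker \<subseteq> Gt" and Ker_G: "Ker \<subseteq> G"
  by (auto simp: Ker_def Gt_iff)

lemma Ker_conj: assumes "g \<in> Gt" "k \<in> Ker" shows "g \<circ> k \<circ> finv g \<in> Ker"
proof -
  have k: "k \<in> Gt" "\<And>b. \<not> odd_sing k b" using assms(2) by (auto simp: Ker_def)
  have g': "finv g \<in> Gt" "g \<circ> k \<in> Gt" using perm_groupD(3,4)[OF groups(2)] assms(1) k by auto
  then have "g \<circ> k \<circ> finv g \<in> Gt" using perm_groupD(3)[OF groups(2)] by blast
  moreover have "\<not> odd_sing (g \<circ> k \<circ> finv g) b" for b
    using odd_sing_comp_Gt[OF Gt_G[OF g'(2)] g'(1), of b] odd_sing_comp_Gt[OF Gt_G[OF assms(1)] k(1), of b]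
      odd_sing_finv[OF assms(1), of b] k(2) by simp
  ultimately show ?thesis by (simp add: Ker_def)
qed

text \<open>Two elements with one singularity each, of the same type, agree up to inversion modulo
  any normal subgroup containing \<open>S\<close>; hence singularities can be removed in pairs.\<close>

lemma Ker_normal_closure:
  assumes M: "perm_group M" "S \<subseteq> M"
    and conj: "\<And>g m. g \<in> Gt \<Longrightarrow> m \<in> M \<Longrightarrow> g \<circ> m \<circ> finv g \<in> M"
  shows "Ker \<subseteq> M"
proof
  fix g assume "g \<in> Ker"
  then show "g \<in> M"
  proof (induction "card (sing g)" arbitrary: g rule: less_induct)
    case less
    have g: "g \<in> Gt" "\<And>b. \<not> odd_sing g b" using less.prems by (auto simp: Ker_def)
    show ?case
    proof (cases "sing g = {}")
      case True
      then show ?thesis using g(1) S_iff M(2) by blast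
    next
      case False
      then obtain v where v: "v \<in> sing g" by blast
      have "\<exists>w. w \<in> sing g \<and> tp w = tp v \<and> w \<noteq> v"
      proof (rule ccontr)
        assume "\<not> ?thesis"
        then have "{x \<in> sing g. tp x = tp v} = {v}" using v by auto
        then show False using g(2)[of "tp v"] by (simp add: odd_sing_def)
      qed
      then obtain w where w: "w \<in> sing g" "tp w = tp v" "w \<noteq> v" by blast
      \<comment> \<open>\<open>n\<close> and \<open>n'\<close> are made singular at the images of
        \<open>w\<close> and \<open>v\<close>, so \<open>n' \<circ> (n \<circ> g)\<close> loses
        exactly these two singular vertices.\<close>
      obtain n where n: "n \<in> Gt" "sing n = {g w}" using one_singularity by blast
      obtain n' where n': "n' \<in> Gt" "sing n' = {n (g v)}" using one_singularity by blast
      have tpp: "tp (n x) = tp x" "tp (g x) = tp x" for x using n(1) g(1) by (auto simp: Gt_iff)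
      \<comment> \<open>\<open>s\<close> moves the image of the singular vertex of \<open>n\<close>
        onto that of \<open>n'\<close>, so the two cancel in
        \<open>n' \<circ> (s \<circ> n)\<close>, which therefore lies in \<open>S\<close>.\<close>
      obtain s where s: "s \<in> S" "s (n (g w)) = n (g v)"
        using S_transitive[of "n (g w)" "n (g v)"] tpp w(2) by auto
      have sG: "s \<in> Gt" "sing s = {}" using s(1) S_iff by auto
      have inj: "n x = n y \<longleftrightarrow> x = y" "g x = g y \<longleftrightarrow> x = y" "s x = s y \<longleftrightarrow> x = y" for x y
        using aut_inj Gt_aut n(1) g(1) sG(1) by auto
      have Gs: "n \<circ> g \<in> Gt" "n' \<circ> (n \<circ> g) \<in> Gt" "s \<circ> n \<in> Gt" "n' \<circ> (s \<circ> n) \<in> Gt"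
        using perm_groupD(3)[OF groups(2)] n(1) n'(1) g(1) sG(1) by auto
      have "sing (n' \<circ> (n \<circ> g)) = sing g - {v, w}"
        using v w inj(1,2) by (auto simp: sing_comp Gt_G Gs n n' g(1))
      then have "card (sing (n' \<circ> (n \<circ> g))) < card (sing g)"
        using v sing_finite[OF Gt_G[OF g(1)]] by (intro psubset_card_mono) auto
      moreover have "n' \<circ> (n \<circ> g) \<in> Ker"
        using Gs(2) odd_sing_comp_Gt[OF Gt_G[OF n'(1)] Gs(1)] odd_sing_comp_Gt[OF Gt_G[OF n(1)] g(1)]
          g(2) odd_sing_single[OF n(2)] odd_sing_single[OF n'(2)] tpp w(2) by (simp add: Ker_def)
      ultimately have a: "n' \<circ> (n \<circ> g) \<in> M" using less.hyps by blast
      have "x \<notin> sing (n' \<circ> (s \<circ> n))" for x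
        using s(2) inj(1,3) by (auto simp: sing_comp Gt_G Gs n n' sG) (metis inj(1,3))+
      then have "n' \<circ> (s \<circ> n) \<in> M" using Gs(4) S_iff M(2) by blast
      \<comment> \<open>This factor removes \<open>s\<close> again and leaves
        \<open>n' \<circ> n\<close>. Its conjugator \<open>n\<close> is not in \<open>Ker\<close>,
        whence the assumption of invariance under \<open>Gt\<close>.\<close>
      moreover have "finv n \<circ> finv s \<circ> finv (finv n) \<in> M"
        using conj perm_groupD(4)[OF groups(2) n(1)] perm_groupD(4)[OF M(1)] s(1) M(2) by blast
      ultimately have "(n' \<circ> (s \<circ> n)) \<circ> (finv n \<circ> finv s \<circ> finv (finv n)) \<in> M"
        using perm_groupD(3)[OF M(1)] by blast
      moreover have "(n' \<circ> (s \<circ> n)) \<circ> (finv n \<circ> finv s \<circ> finv (finv n)) = n' \<circ> n"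
        using aut_finv[OF Gt_aut[OF n(1)]] aut_finv[OF Gt_aut[OF sG(1)]] autD(1)[OF Gt_aut[OF n(1)]]
        by (simp add: fun_eq_iff)
      ultimately have b: "finv (n' \<circ> n) \<in> M" using perm_groupD(4)[OF M(1)] by simp
      have "bij (n' \<circ> n)" using autD(1)[OF Gt_aut] n(1) n'(1) bij_comp by blast
      then have "finv (n' \<circ> n) \<circ> (n' \<circ> (n \<circ> g)) = g"
        by (simp add: fun_eq_iff) (metis bij_is_inj comp_apply inv_f_f)
      then show ?thesis using perm_groupD(3)[OF M(1) b a] by simp
    qed
  qed
qed

text \<open>If \<open>F2\<close> acted freely, local permutations at adjacent vertices, which agree
  on the colour of their edge, would coincide. Each element of \<open>S\<close> would have a
  constant local permutation, and those with the identity would form a normal subgroup, neither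
  trivial nor all of \<open>S\<close>, against simplicity.\<close>

lemma nonfree: "\<exists>t\<in>F2. \<exists>a. t a = a \<and> t \<noteq> id"
proof (rule ccontr)
  assume free: "\<not> ?thesis"
  define L where "L = {g \<in> S. \<forall>v. lp g v = id}"
  have SG: "g \<in> S \<Longrightarrow> g \<in> aut adj" for g by (simp add: S_iff Gt_aut)
  have lpF2: "g \<in> S \<Longrightarrow> lp g v \<in> F2" for g v by (auto simp: S_iff sing_def)
  have const: "lp g u = lp g v" if "g \<in> S" for g u v
  proof (induction v rule: connected_induct[where r = u])
    case (step x y)
    have e: "lp g x (c {x, y}) = lp g y (c {x, y})"
      using lp_app[OF step(2), of g] lp_app[OF adj_sym[OF step(2)], of g] by (simp add: insert_commute)
    have bx: "bij (lp g x)" using lp_bij[OF SG[OF that]] .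
    have "finv (lp g x) \<circ> lp g y \<in> F2" using perm_groupD(3,4)[OF F2] lpF2[OF that] by blast
    moreover have "(finv (lp g x) \<circ> lp g y) (c {x, y}) = c {x, y}"
      using e[symmetric] bx by (simp add: bij_is_inj)
    ultimately have "finv (lp g x) \<circ> lp g y = id" using free by blast
    then have "lp g x \<circ> (finv (lp g x) \<circ> lp g y) = lp g x" by simp
    then have "lp g x = lp g y"
      using surj_iff[THEN iffD1, OF bij_is_surj[OF bx]] by (simp add: comp_assoc[symmetric])
    then show ?case using step(1) by simp
  qed simp
  have "perm_normal L S"
    unfolding perm_normal_def
  proof (intro conjI ballI)
    show "perm_group L"
      unfolding perm_group_def L_def
    proof (intro conjI ballI)
      show "finv g \<in> {g \<in> S. \<forall>v. lp g v = id}" if "g \<in> {g \<in> S. \<forall>v. lp g v = id}" for g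
      proof -
        have g: "g \<in> S" "\<And>v. lp g v = id" using that by auto
        have "lp (finv g) v = id" for v
          using lp_finv_comp[OF SG[OF g(1)], of "finv g v"] aut_finv(2)[OF SG[OF g(1)]] g(2) by simp
        then show ?thesis using perm_groupD(4)[OF groups(3) g(1)] by blast
      qed
    qed (use perm_groupD[OF groups(3)] lp_id lp_comp SG in auto)
    show "L \<subseteq> S" by (auto simp: L_def)
    show "g \<circ> h \<circ> finv g \<in> L" if "g \<in> S" "h \<in> L" for g h
    proof -
      have h: "h \<in> S" "\<And>v. lp h v = id" using that by (auto simp: L_def)
      have g': "finv g \<in> S" using perm_groupD(4)[OF groups(3) that(1)] .
      have "lp (g \<circ> h \<circ> finv g) v = id" for v
      proof -
        have "lp (g \<circ> h \<circ> finv g) v = lp g (h (finv g v)) \<circ> lp (finv g) v"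
          using lp_comp[OF SG[OF g'], of "g \<circ> h"] lp_comp[OF SG[OF h(1)], of g] h(2) by simp
        also have "lp g (h (finv g v)) = lp g (finv g v)" using const[OF that(1)] .
        also have "lp g (finv g v) \<circ> lp (finv g) v = lp (g \<circ> finv g) v"
          using lp_comp[OF SG[OF g'], of g] by simp
        also have "g \<circ> finv g = id" using aut_finv(2)[OF SG[OF that(1)]] by (simp add: fun_eq_iff)
        finally show ?thesis unfolding lp_id .
      qed
      moreover have "g \<circ> h \<circ> finv g \<in> S" using perm_groupD(3)[OF groups(3)] that(1) h(1) g' by blast
      ultimately show ?thesis by (simp add: L_def)
    qed
  qed
  then have "L = S \<or> L = {id}" using simple simple_PG_iff[OF groups(3)] by blast
  moreover have "L \<noteq> {id}"
  proof -
    obtain u v where uv: "adj u v" using nbr by blast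
    obtain w where w: "adj v w" "w \<noteq> u" using third_nbr by blast
    obtain s where s: "s \<in> S" "s u = w" "\<And>x. lp s x = id"
      using S_transitive[of u w] tp_adj[OF uv] tp_adj[OF w(1)] by blast
    then have "s \<in> L" "s \<noteq> id" using w(2) by (auto simp: L_def)
    then show ?thesis by blast
  qed
  moreover have "L \<noteq> S"
  proof -
    \<comment> \<open>Otherwise \<open>F\<close> is trivial, hence so is \<open>hat F\<close>, which
      contains \<open>F1\<close>; this leaves no room for index two.\<close>
    have "F2 \<noteq> {id}"
    proof
      assume a: "F2 = {id}"
      then have "F = {id}" using sub(1) perm_groupD(2)[OF F] by blast
      then have "t = id" if "t \<in> F1" for t using F1D(2)[OF that] by (auto simp: fun_eq_iff)
      then have "F1 \<subseteq> F2" using a by blast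
      then show False using index_two(1)[OF F1 F2 sub(2) idx] by blast
    qed
    then obtain f where f: "f \<in> F2" "f \<noteq> id" using perm_groupD(2)[OF F2] by blast
    have fF1: "f \<in> F1" using f sub by blast
    obtain g where g: "g \<in> aut adj" "g undefined = undefined" "lp g undefined = f"
      "\<And>x. x \<noteq> undefined \<Longrightarrow> lp g x \<in> F"
      using extension_local[of f F undefined] F1D[OF fF1] perm_groupD(1)[OF F] by blast
    have "{x. lp g x \<notin> F} \<subseteq> {undefined}" using g(4) by blast
    then have "finite {x. lp g x \<notin> F}" using finite_subset by blast
    moreover have "lp g x \<in> F2" for x using g f sub by (cases "x = undefined") auto
    ultimately have "g \<in> S" using g(1) fix_tp[OF g(1,2)] by (simp add: type_pres_eq G2_iff)
    moreover have "g \<notin> L" using g f by (auto simp: L_def)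
    ultimately show ?thesis by blast
  qed
  ultimately show False by blast
qed

text \<open>An automorphism with local permutation \<open>t\<close> at the fixed vertex
  \<open>v\<close> also fixes the neighbour of colour \<open>a\<close>. Replacing it by the identity
  beyond that edge keeps \<open>t\<close> at \<open>v\<close>, so the result is nontrivial.\<close>

lemma supported_element:
  assumes t: "t \<in> F2" "t a = a" "t \<noteq> id"
  shows "\<exists>x\<in>S. x \<noteq> id \<and> (\<forall>z. z \<notin> T (nbr v a) v \<longrightarrow> x z = z) \<and> x v = v"
proof -
  have tF1: "t \<in> F1" using t sub by blast
  obtain g where g: "g \<in> aut adj" "g v = v" "lp g v = t" "\<And>x. x \<noteq> v \<Longrightarrow> lp g x \<in> F"
    using extension_local[of t F v] F1D[OF tF1] perm_groupD(1)[OF F] by blast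
  define u where "u = nbr v a"
  have u: "adj v u" "c {v, u} = a" using nbr by (auto simp: u_def)
  have gu: "g u = u"
  proof (rule color_inj[of v])
    show "adj v (g u)" using autD(2)[OF g(1), of v u] g(2) u(1) by simp
    show "c {v, g u} = c {v, u}" using lp_app[OF u(1), of g] g(2,3) u(2) t(2) by simp
  qed (fact u(1))
  define f where "f x = (if x \<in> T v u then x else g x)" for x
  have f: "f \<in> aut adj" "\<And>x. lp f x = (if x \<in> T v u then id else lp g x)"
    using edge_independence[OF g(1) u(1) g(2) gu] by (auto simp: f_def[abs_def])
  have "{x. lp f x \<notin> F} \<subseteq> {v}" using g(4) f(2) perm_groupD(2)[OF F] by auto
  then have "finite {x. lp f x \<notin> F}" using finite_subset by blast
  moreover have "lp f x \<in> F2" for x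
    using f(2) g t sub perm_groupD(2)[OF F2] by (cases "x = v") auto
  moreover have fv: "f v = v" using g(2) by (simp add: f_def)
  ultimately have "f \<in> S" using f(1) fix_tp[OF f(1) fv] by (simp add: type_pres_eq G2_iff)
  moreover have "f \<noteq> id" using f(2)[of v] T_notin[of v u] g(3) t(3) lp_id by auto
  moreover have "f z = z" if "z \<notin> T u v" for z
    using that T_compl[OF u(1)] by (auto simp: f_def)
  ultimately show ?thesis using fv u_def by blast
qed

lemma S_in_normal:
  assumes H: "perm_normal H Ker" "H \<noteq> {id}"
  shows "S \<subseteq> H"
proof -
  have HG: "perm_group H" "H \<subseteq> Ker" using H by (auto simp: perm_normal_def)
  obtain h where h: "h \<in> H" "h \<noteq> id" using H(2) perm_groupD(2)[OF HG(1)] by blast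
  have hG: "h \<in> Gt" "h \<in> G" "h \<in> aut adj" using h HG Ker_Gt Gt_G G_aut by blast+
  obtain t a where t: "t \<in> F2" "t a = a" "t \<noteq> id" using nonfree by blast
  obtain v where v: "T (nbr v a) v \<inter> h ` T (nbr v a) v = {}" "T (nbr v a) v \<inter> sing h = {}"
    using displaced_colored_half_tree[OF hG(3) h(2) sing_finite[OF hG(2)]] by blast
  define B where "B = T (nbr v a) v"
  obtain x where x: "x \<in> S" "x \<noteq> id" "\<And>z. z \<notin> B \<Longrightarrow> x z = z"
    using supported_element[OF t, of v] unfolding B_def by blast
  have xG: "x \<in> Gt" "x \<in> G" "x \<in> aut adj" "sing x = {}" using x(1) Gt_G G_aut S_iff by blast+
  have xB: "x u \<in> B" if "u \<in> B" for u
    using x(3)[of "x u"] aut_inj[OF xG(3)] that by metis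
  let ?y = "h \<circ> x \<circ> finv h \<circ> finv x"
  have inv: "finv h \<in> H" "finv h \<in> Gt" "finv h \<in> G" "finv x \<in> S" "finv x \<in> Gt" "finv x \<in> G"
    using perm_groupD(4)[OF HG(1) h(1)] perm_groupD(4)[OF groups(3) x(1)] HG(2) Ker_Gt Gt_G S_iff by blast+
  have "x \<circ> finv h \<circ> finv x \<in> H" using H(1) x(1) S_Ker inv(1) unfolding perm_normal_def by blast
  then have yH: "?y \<in> H" using perm_groupD(3)[OF HG(1) h(1)] by (simp add: comp_assoc)
  have ne: "?y \<noteq> id" by (rule comm_ne_id[OF hG(3) xG(3) x(2,3)]) (use v(1) in \<open>simp_all add: B_def\<close>)
  have comps: "h \<circ> x \<in> G" "h \<circ> x \<circ> finv h \<in> G"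
    using perm_groupD(3)[OF groups(1)] hG(2) xG(2) inv(3) by blast+
  have "z \<notin> sing (h \<circ> x \<circ> finv h)" for z
  proof -
    define u where "u = finv h z"
    have z: "z = h u" using aut_finv(2)[OF hG(3)] by (simp add: u_def)
    \<comment> \<open>At \<open>h u\<close> the conjugate of \<open>x\<close> collects the
      singularities of \<open>h\<close> at \<open>x u\<close> and at \<open>u\<close>. For
      \<open>u\<close> in \<open>B\<close> neither vertex is singular, and outside \<open>B\<close>
      they are equal; either way they cancel.\<close>
    have "x u \<in> sing h \<longleftrightarrow> u \<in> sing h"
      using xB x(3) v(2) by (cases "u \<in> B") (auto simp: B_def)
    then show ?thesis
      unfolding z using sing_comp[OF comps(1) inv(3), of "h u"] sing_comp[OF hG(2) xG(2), of u]
        sing_finv[OF hG(2), of u] aut_finv(1)[OF hG(3)] xG(4) by auto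
  qed
  moreover have "sing (finv x) = {}" using inv(4) S_iff by blast
  ultimately have "sing ?y = {}" using sing_comp[OF comps(2) inv(6)] by auto
  moreover have "?y \<in> Gt" using yH HG(2) Ker_Gt by blast
  ultimately have yS: "?y \<in> S" using S_iff by blast
  have "perm_normal (H \<inter> S) S"
    using H(1) groups(3) S_Ker unfolding perm_normal_def perm_group_def by (auto simp: subset_iff)
  then have "H \<inter> S = S \<or> H \<inter> S = {id}" using simple simple_PG_iff[OF groups(3)] by blast
  then show ?thesis using yH yS ne by blast
qed

lemma Ker_simple: "simple_abs (PG Ker)"
  unfolding simple_PG_iff[OF perm_group_Ker]
proof (intro conjI allI impI)
  have "S \<noteq> {id}" using simple simple_PG_iff[OF groups(3)] by blast
  then show "Ker \<noteq> {id}" using S_Ker perm_groupD(2)[OF groups(3)] by blast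
next
  fix H assume H: "perm_normal H Ker"
  show "H = Ker \<or> H = {id}"
  proof (cases "H = {id}")
    case False
    have HG: "perm_group H" "H \<subseteq> Ker" using H by (auto simp: perm_normal_def)
    \<comment> \<open>\<open>C g\<close> is the conjugate of \<open>H\<close> by the inverse of
      \<open>g\<close>. It is again normal in \<open>Ker\<close>, because \<open>Gt\<close>
      normalizes \<open>Ker\<close>.\<close>
    define C where "C g = {x. g \<circ> x \<circ> finv g \<in> H}" for g :: "'v \<Rightarrow> 'v"
    have C: "perm_group (C g)" if "g \<in> Gt" for g
      unfolding C_def by (rule perm_group_conj[OF HG(1) autD(1)[OF Gt_aut[OF that]]])
    have unconj: "finv g \<circ> (g \<circ> x \<circ> finv g) \<circ> g = x" if "g \<in> Gt" for g x
      using aut_finv[OF Gt_aut[OF that]] by (simp add: fun_eq_iff)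
    have CK: "C g \<subseteq> Ker" if g: "g \<in> Gt" for g
    proof
      fix x assume "x \<in> C g"
      then have "g \<circ> x \<circ> finv g \<in> Ker" using HG by (auto simp: C_def)
      then have "finv g \<circ> (g \<circ> x \<circ> finv g) \<circ> finv (finv g) \<in> Ker"
        by (rule Ker_conj[OF perm_groupD(4)[OF groups(2) g]])
      then show "x \<in> Ker" using unconj[OF g] autD(1)[OF Gt_aut[OF g]] by simp
    qed
    have SC: "S \<subseteq> C g" if g: "g \<in> Gt" for g
    proof (rule S_in_normal)
      have bg: "finv g \<circ> g = id" "g \<circ> finv g = id"
        using aut_finv[OF Gt_aut[OF g]] by (simp_all add: fun_eq_iff)
      show "perm_normal (C g) Ker"
        unfolding perm_normal_def
      proof (intro conjI ballI C[OF g] CK[OF g])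
        fix k x assume k: "k \<in> Ker" and x: "x \<in> C g"
        have "g \<circ> k \<circ> finv g \<in> Ker" using Ker_conj g k by blast
        then have "(g \<circ> k \<circ> finv g) \<circ> (g \<circ> x \<circ> finv g) \<circ> finv (g \<circ> k \<circ> finv g) \<in> H"
          using H x by (auto simp: perm_normal_def C_def)
        moreover have "finv (g \<circ> k \<circ> finv g) = g \<circ> finv k \<circ> finv g"
          using finv_conj[OF autD(1)[OF Gt_aut[OF g]] perm_groupD(1)[OF perm_group_Ker k]] .
        moreover have "(g \<circ> k \<circ> finv g) \<circ> (g \<circ> x \<circ> finv g) \<circ> (g \<circ> finv k \<circ> finv g)
            = g \<circ> (k \<circ> x \<circ> finv k) \<circ> finv g"
          using aut_finv[OF Gt_aut[OF g]] by (simp add: fun_eq_iff)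
        ultimately show "k \<circ> x \<circ> finv k \<in> C g" by (simp add: C_def)
      qed
      obtain h where h: "h \<in> H" "h \<noteq> id" using False perm_groupD(2)[OF HG(1)] by blast
      have "g \<circ> (finv g \<circ> h \<circ> g) \<circ> finv g = h" using aut_finv[OF Gt_aut[OF g]] by (simp add: fun_eq_iff)
      then have "finv g \<circ> h \<circ> g \<in> C g" using h by (simp add: C_def)
      moreover have "finv g \<circ> h \<circ> g \<noteq> id"
      proof
        assume "finv g \<circ> h \<circ> g = id"
        then have "h = id" using \<open>g \<circ> (finv g \<circ> h \<circ> g) \<circ> finv g = h\<close> bg by simp
        then show False using h by simp
      qed
      ultimately show "C g \<noteq> {id}" by blast
    qed
    \<comment> \<open>The largest subset of \<open>H\<close> invariant under \<open>Gt\<close>; the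
      factor for \<open>id\<close> gives the inclusion in \<open>H\<close>.\<close>
    define M where "M = {x. \<forall>g\<in>Gt. x \<in> C g}"
    have idG: "id \<in> Gt" using perm_groupD(2)[OF groups(2)] .
    have Cid: "C id = H" by (simp add: C_def)
    have "perm_group M"
      unfolding perm_group_def
    proof (intro conjI ballI)
      show "M \<subseteq> {g. bij g}" using perm_groupD(1)[OF HG(1)] idG Cid by (auto simp: M_def)
    qed (use perm_groupD[OF C] in \<open>auto simp: M_def\<close>)
    moreover have "S \<subseteq> M" using SC by (auto simp: M_def)
    moreover have "g \<circ> m \<circ> finv g \<in> M" if "g \<in> Gt" "m \<in> M" for g m
      unfolding M_def
    proof (intro CollectI ballI)
      fix k assume k: "k \<in> Gt"
      then have "m \<in> C (k \<circ> g)" using that perm_groupD(3)[OF groups(2)] by (auto simp: M_def)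
      moreover have "finv (k \<circ> g) = finv g \<circ> finv k"
        using autD(1)[OF Gt_aut] k that(1) by (simp add: o_inv_distrib)
      ultimately show "g \<circ> m \<circ> finv g \<in> C k" by (simp add: C_def comp_assoc)
    qed
    ultimately have "Ker \<subseteq> M" by (rule Ker_normal_closure)
    then have "Ker \<subseteq> H" using idG Cid by (auto simp: M_def)
    then show ?thesis using HG by blast
  qed simp
qed

end

section \<open>N(F,F') as the parity kernel, and its index\<close>

context index_two_data begin

abbreviation "N \<equiv> N_grp adj c F F1"

lemma edge_stab_subset: "edge_stab G e \<subseteq> aut adj"
  by (auto simp: edge_stab_def G_aut)

lemma autG_eq: "autG adj = PG (aut adj)"
  by (simp add: autG_def)

lemma N_eq:
  "N = generate (PG (aut adj)) (\<Union>e\<in>edges adj. generate (PG (aut adj)) (commutators (edge_stab G e)))"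
  by (simp add: N_grp_def autG_eq derived_PG[OF perm_group_aut edge_stab_subset])

lemma commutators_aut: "commutators (edge_stab G e) \<subseteq> aut adj"
  using edge_stab_subset[of e] by (auto simp: commutators_def intro!: aut_comp aut_inv)

lemma generate_commutators_aut: "generate (PG (aut adj)) (commutators (edge_stab G e)) \<subseteq> aut adj"
  by (rule generate_least[OF perm_group_aut commutators_aut perm_group_aut commutators_aut])

text \<open>Replaces the two nested generations by one minimality property: only commutators within
  edge stabilizers need to be tested.\<close>

lemma N_least:
  assumes B: "perm_group B" and C: "\<And>e. e \<in> edges adj \<Longrightarrow> commutators (edge_stab G e) \<subseteq> B"
  shows "N \<subseteq> B"
  unfolding N_eq
proof (rule generate_least[OF perm_group_aut _ B])
  show "(\<Union>e\<in>edges adj. generate (PG (aut adj)) (commutators (edge_stab G e))) \<subseteq> aut adj"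
    using generate_commutators_aut by blast
  show "(\<Union>e\<in>edges adj. generate (PG (aut adj)) (commutators (edge_stab G e))) \<subseteq> B"
    using generate_least[OF perm_group_aut commutators_aut B C] by blast
qed

lemma commutators_N:
  assumes "e \<in> edges adj"
  shows "commutators (edge_stab G e) \<subseteq> N"
proof -
  have "commutators (edge_stab G e) \<subseteq> generate (PG (aut adj)) (commutators (edge_stab G e))"
    by (rule perm_group_generate(2)[OF perm_group_aut commutators_aut])
  also have "\<dots> \<subseteq> N"
    unfolding N_eq
    using perm_group_generate(2)[OF perm_group_aut,
        of "\<Union>e\<in>edges adj. generate (PG (aut adj)) (commutators (edge_stab G e))"]
      generate_commutators_aut assms by blast
  finally show ?thesis .
qed

lemma perm_group_N: "perm_group N"
  unfolding N_eq
  by (rule perm_group_generate(1)[OF perm_group_aut]) (use generate_commutators_aut in blast)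

lemma edge_stab_Gt: "e \<in> edges adj \<Longrightarrow> edge_stab G e \<subseteq> Gt"
  using fix_tp[OF G_aut] unfolding edge_stab_def edges_def by (auto simp: Gt_iff)

text \<open>On \<open>Gt\<close>, which contains all edge stabilizers, each parity is a homomorphism
  to a group of order two and vanishes on commutators.\<close>

lemma N_Ker: "N \<subseteq> Ker"
proof (rule N_least[OF perm_group_Ker])
  fix e assume e: "e \<in> edges adj"
  show "commutators (edge_stab G e) \<subseteq> Ker"
  proof
    fix x assume "x \<in> commutators (edge_stab G e)"
    then obtain g h where x: "x = g \<circ> h \<circ> finv g \<circ> finv h" and gh: "g \<in> Gt" "h \<in> Gt"
      using edge_stab_Gt[OF e] unfolding commutators_def by blast
    have m: "finv g \<in> Gt" "finv h \<in> Gt" "g \<circ> h \<in> Gt" "g \<circ> h \<circ> finv g \<in> Gt" "x \<in> Gt"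
      unfolding x using perm_groupD(3,4)[OF groups(2)] gh by blast+
    have "\<not> odd_sing x b" for b
      unfolding x using odd_sing_comp_Gt[OF Gt_G[OF m(4)] m(2), of b]
        odd_sing_comp_Gt[OF Gt_G[OF m(3)] m(1), of b] odd_sing_comp_Gt[OF Gt_G[OF gh(1)] gh(2), of b]
        odd_sing_finv[OF gh(1), of b] odd_sing_finv[OF gh(2), of b] by auto
    then show "x \<in> Ker" using m(5) by (simp add: Ker_def)
  qed
qed

text \<open>Conjugation by \<open>g\<close> carries the stabilizer of an edge to the stabilizer of
  its image, so it permutes the generating commutators.\<close>

lemma N_conj:
  assumes g: "g \<in> G" and n: "n \<in> N"
  shows "g \<circ> n \<circ> finv g \<in> N"
proof -
  note ga = G_aut[OF g]
  have "N \<subseteq> {x. g \<circ> x \<circ> finv g \<in> N}"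
  proof (rule N_least)
    show "perm_group {x. g \<circ> x \<circ> finv g \<in> N}"
      by (rule perm_group_conj[OF perm_group_N autD(1)[OF ga]])
    fix e assume e: "e \<in> edges adj"
    have e': "g ` e \<in> edges adj"
      using e autD(2)[OF ga] unfolding edges_def by auto
    have st: "g \<circ> h \<circ> finv g \<in> edge_stab G (g ` e)" if "h \<in> edge_stab G e" for h
    proof -
      have "g \<circ> h \<circ> finv g \<in> G"
        using perm_groupD(3,4)[OF groups(1)] g that unfolding edge_stab_def by blast
      then show ?thesis using that aut_finv(1)[OF ga] by (auto simp: edge_stab_def)
    qed
    show "commutators (edge_stab G e) \<subseteq> {x. g \<circ> x \<circ> finv g \<in> N}"
    proof (rule subsetI, rule CollectI)
      fix x assume "x \<in> commutators (edge_stab G e)"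
      then obtain h k where x: "x = h \<circ> k \<circ> finv h \<circ> finv k"
        and hk: "h \<in> edge_stab G e" "k \<in> edge_stab G e"
        unfolding commutators_def by blast
      have fi: "finv (g \<circ> h \<circ> finv g) = g \<circ> finv h \<circ> finv g" if "h \<in> edge_stab G e" for h
        using finv_conj[OF autD(1)[OF ga] autD(1)] that edge_stab_subset by blast
      have "(g \<circ> h \<circ> finv g) \<circ> (g \<circ> k \<circ> finv g) \<circ> finv (g \<circ> h \<circ> finv g) \<circ> finv (g \<circ> k \<circ> finv g)
          = g \<circ> x \<circ> finv g"
        unfolding fi[OF hk(1)] fi[OF hk(2)] x by (rule ext) (simp add: aut_finv(1)[OF ga])
      moreover have "(g \<circ> h \<circ> finv g) \<circ> (g \<circ> k \<circ> finv g) \<circ> finv (g \<circ> h \<circ> finv g) \<circ> finv (g \<circ> k \<circ> finv g)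
          \<in> commutators (edge_stab G (g ` e))"
        using st[OF hk(1)] st[OF hk(2)] unfolding commutators_def by blast
      ultimately show "g \<circ> x \<circ> finv g \<in> N" using subsetD[OF commutators_N[OF e']] by metis
    qed
  qed
  then show ?thesis using n by blast
qed

text \<open>Both factors of the commutator must fix a common edge. \<open>y\<close> fixes the edge
  of colour \<open>a\<close> at \<open>v\<close>; \<open>x\<close> is supported on a half-tree
  disjoint from its image under \<open>y\<close>, so it fixes every fixed vertex of
  \<open>y\<close>.\<close>

lemma N_nontrivial: "N \<noteq> {id}"
proof -
  obtain t a where t: "t \<in> F2" "t a = a" "t \<noteq> id" using nonfree by blast
  fix v :: 'v
  obtain y where y: "y \<in> S" "y \<noteq> id" "\<And>z. z \<notin> T (nbr v a) v \<Longrightarrow> y z = z" "y v = v"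
    using supported_element[OF t, of v] by blast
  have yG: "y \<in> G" "y \<in> aut adj" using y(1) S_iff Gt_G Gt_aut by blast+
  obtain w where w: "T (nbr w a) w \<inter> y ` T (nbr w a) w = {}"
    using displaced_colored_half_tree[OF yG(2) y(2), of "{}"] by blast
  obtain x where x: "x \<in> S" "x \<noteq> id" "\<And>z. z \<notin> T (nbr w a) w \<Longrightarrow> x z = z"
    using supported_element[OF t, of w] by blast
  have xG: "x \<in> G" "x \<in> aut adj" using x(1) S_iff Gt_G Gt_aut by blast+
  have yfix: "y (nbr v a) = nbr v a" by (rule y(3)) (rule T_notin)
  have xfix: "x z = z" if "y z = z" for z using x(3)[of z] w that by (metis disjoint_iff image_eqI)
  have e: "{v, nbr v a} \<in> edges adj" using nbr(1) unfolding edges_def by blast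
  have "y \<in> edge_stab G {v, nbr v a}" "x \<in> edge_stab G {v, nbr v a}"
    using yG xG yfix y(4) xfix by (auto simp: edge_stab_def)
  then have "y \<circ> x \<circ> finv y \<circ> finv x \<in> N"
    using commutators_N[OF e] unfolding commutators_def by blast
  moreover have "y \<circ> x \<circ> finv y \<circ> finv x \<noteq> id" by (rule comm_ne_id[OF yG(2) xG(2) x(2,3) w])
  ultimately show ?thesis by blast
qed

lemma N_eq_Ker: "N = Ker"
proof -
  have "perm_normal N Ker"
    unfolding perm_normal_def using perm_group_N N_Ker N_conj Ker_G by blast
  then show ?thesis using Ker_simple simple_PG_iff[OF perm_group_Ker] N_nontrivial by blast
qed

lemma vertex_of_type: "\<exists>v. tp v = b"
proof -
  obtain u v where "adj u v" using nbr by blast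
  then show ?thesis using tp_adj by (cases "tp u = b") auto
qed

text \<open>Not a homomorphism to the direct product, since exchanging types swaps the parities; yet
  its fibres on \<open>G\<close> are exactly the right cosets of \<open>Ker\<close>. Its three
  independent bits account for the index 8.\<close>

definition invar :: "('v \<Rightarrow> 'v) \<Rightarrow> bool \<times> bool \<times> bool" where
  "invar g = (tp (g undefined) = tp undefined, odd_sing g True, odd_sing g False)"

lemma invar_eq_iff:
  assumes "g \<in> G" "h \<in> G"
  shows "invar g = invar h \<longleftrightarrow> g \<circ> finv h \<in> Ker"
proof -
  let ?k = "g \<circ> finv h"
  have k: "?k \<in> G" using perm_groupD(3,4)[OF groups(1)] assms by blast
  have g: "g = ?k \<circ> h" using aut_finv(1)[OF G_aut[OF assms(2)]] by (simp add: fun_eq_iff)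
  have tpk: "tp (g undefined) = tp (h undefined) \<longleftrightarrow> ?k \<in> Gt"
    using aut_tp[OF G_aut[OF k], of "h undefined"] k aut_finv(1)[OF G_aut[OF assms(2)]]
    by (auto simp: Gt_iff)
  have o: "odd_sing g b \<longleftrightarrow> (odd_sing ?k (if tp (h undefined) = tp undefined then b else \<not> b) \<noteq> odd_sing h b)" for b
  proof -
    have "tp x = b \<longleftrightarrow> tp (h x) = (if tp (h undefined) = tp undefined then b else \<not> b)" for x
      using aut_tp[OF G_aut[OF assms(2)], of undefined x] by auto
    then show ?thesis by (subst g) (rule odd_sing_comp[OF k assms(2)])
  qed
  show ?thesis
  proof
    assume "invar g = invar h"
    then have i: "tp (g undefined) = tp (h undefined)" "odd_sing g b = odd_sing h b" for b
      by (cases b; auto simp: invar_def)+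
    have "\<not> odd_sing ?k b" for b
      using o[of "if tp (h undefined) = tp undefined then b else \<not> b"] i(2) by (auto split: if_splits)
    then show "?k \<in> Ker" using tpk i(1) by (simp add: Ker_def)
  next
    assume "?k \<in> Ker"
    then have "?k \<in> Gt" "\<And>b. \<not> odd_sing ?k b" by (auto simp: Ker_def)
    then show "invar g = invar h" using tpk o by (auto simp: invar_def)
  qed
qed

lemma invar_surj: "invar ` G = UNIV"
proof -
  have "\<exists>g\<in>G. invar g = (a, b1, b2)" for a b1 b2
  proof -
    \<comment> \<open>An equation between booleans: \<open>v\<close> has the type of the base vertex
      exactly when \<open>a\<close> holds.\<close>
    obtain v where v: "tp v \<longleftrightarrow> (tp undefined = a)" using vertex_of_type by blast
    obtain t where t: "t \<in> G" "t undefined = v" "\<And>x. lp t x = id" using translation by blast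
    have st: "sing t = {}" using t(3) perm_groupD(2)[OF F2] by (simp add: sing_def)
    have m: "\<exists>m\<in>Gt. odd_sing m b = p \<and> \<not> odd_sing m (\<not> b)" for b p
    proof (cases p)
      case True
      obtain x m where "tp x = b" "m \<in> Gt" "sing m = {x}" using vertex_of_type one_singularity by metis
      then show ?thesis using odd_sing_single[of m x] True by (intro bexI[of _ m]) auto
    next
      case False
      then show ?thesis using odd_sing_empty[OF sing_id] perm_groupD(2)[OF groups(2)] by blast
    qed
    obtain m1 where m1: "m1 \<in> Gt" "odd_sing m1 True = b1" "\<not> odd_sing m1 False" using m[of True b1] by auto
    obtain m2 where m2: "m2 \<in> Gt" "odd_sing m2 False = b2" "\<not> odd_sing m2 True" using m[of False b2] by auto
    have G1: "m1 \<circ> m2 \<in> Gt" using perm_groupD(3)[OF groups(2) m1(1) m2(1)] .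
    have G2: "t \<circ> (m1 \<circ> m2) \<in> G" using perm_groupD(3)[OF groups(1) t(1) Gt_G[OF G1]] .
    have "odd_sing (t \<circ> (m1 \<circ> m2)) b \<longleftrightarrow> (odd_sing m1 b \<noteq> odd_sing m2 b)" for b
      using odd_sing_comp_Gt[OF t(1) G1, of b] odd_sing_comp_Gt[OF Gt_G[OF m1(1)] m2(1), of b]
        odd_sing_empty[OF st] by simp
    moreover have "tp ((t \<circ> (m1 \<circ> m2)) undefined) = tp undefined \<longleftrightarrow> a"
    proof -
      have "tp ((m1 \<circ> m2) undefined) = tp undefined" using G1 by (simp add: Gt_iff)
      then have "tp ((t \<circ> (m1 \<circ> m2)) undefined) = tp (t undefined)"
        using aut_tp[OF G_aut[OF t(1)], of undefined "(m1 \<circ> m2) undefined"] by auto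
      then show ?thesis using t(2) v by auto
    qed
    ultimately show ?thesis using G2 m1 m2 by (intro bexI[of _ "t \<circ> (m1 \<circ> m2)"]) (simp_all add: invar_def)
  qed
  then show ?thesis by (auto simp: image_iff) metis
qed

lemma Ker_index: "index (PG G) Ker = 8"
proof -
  define co where "co g = (\<lambda>h. h \<circ> g) ` Ker" for g :: "'v \<Rightarrow> 'v"
  have co: "co g = co h \<longleftrightarrow> invar g = invar h" if "g \<in> G" "h \<in> G" for g h
  proof -
    have fh: "finv h \<circ> h = id" using autD(1)[OF G_aut[OF that(2)]] by (simp add: bij_is_inj)
    have fh': "h \<circ> finv h = id" using aut_finv(2)[OF G_aut[OF that(2)]] by (simp add: fun_eq_iff)
    have g: "g = (g \<circ> finv h) \<circ> h" using fh by (simp add: comp_assoc)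
    have "g \<circ> finv h \<in> Ker" if "co g = co h"
    proof -
      have "g \<in> co g" unfolding co_def
        by (rule image_eqI[of _ _ id]) (use perm_groupD(2)[OF perm_group_Ker] in auto)
      then have "g \<in> co h" using that by simp
      then obtain k where "k \<in> Ker" "g = k \<circ> h" by (auto simp: co_def)
      then show ?thesis using fh' by (simp add: comp_assoc)
    qed
    moreover have "co g = co h" if k: "g \<circ> finv h \<in> Ker"
    proof
      show "co g \<subseteq> co h"
      proof
        fix z assume "z \<in> co g"
        then obtain k' where "k' \<in> Ker" "z = k' \<circ> g" by (auto simp: co_def)
        then have "z = (k' \<circ> (g \<circ> finv h)) \<circ> h" "k' \<circ> (g \<circ> finv h) \<in> Ker"
          using g perm_groupD(3)[OF perm_group_Ker _ k] by (simp_all add: comp_assoc)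
        then show "z \<in> co h" unfolding co_def by blast
      qed
      show "co h \<subseteq> co g"
      proof
        fix z assume "z \<in> co h"
        then obtain k' where k': "k' \<in> Ker" "z = k' \<circ> h" by (auto simp: co_def)
        let ?k = "g \<circ> finv h"
        have "finv ?k \<circ> ?k = id" using perm_groupD(1)[OF perm_group_Ker k] by (simp add: bij_is_inj)
        then have "z = (k' \<circ> finv ?k) \<circ> (?k \<circ> h)" using k'(2) by (metis comp_assoc comp_id)
        then have "z = (k' \<circ> finv ?k) \<circ> g" using g by simp
        moreover have "k' \<circ> finv ?k \<in> Ker" using perm_groupD(3,4)[OF perm_group_Ker] k k'(1) by blast
        ultimately show "z \<in> co g" unfolding co_def by blast
      qed
    qed
    ultimately show ?thesis using invar_eq_iff[OF that] by blast
  qed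
  have "index (PG G) Ker = card (co ` G)"
    using index_PG[OF groups(1) Ker_G] by (simp add: co_def[abs_def])
  also have "\<dots> = card (invar ` G)" by (rule card_image_cong) (rule co)
  also have "\<dots> = 8" unfolding invar_surj by (simp add: card_UNIV_bool flip: UNIV_Times_UNIV)
  finally show ?thesis .
qed

lemma index_two_result:
  "subgroup N (PG G)" "simple_abs (PG N)" "index (PG G) N = 8"
  using Ker_simple Ker_index perm_group_Ker Ker_G subgroup_PG_iff[OF groups(1)] by (simp_all add: N_eq_Ker)

end

section \<open>Simplicity of the type-preserving universal group\<close>

locale tits = colored_tree adj c
  for adj :: "'v \<Rightarrow> 'v \<Rightarrow> bool" and c :: "'v set \<Rightarrow> 'a::finite" +
  fixes F :: "('a \<Rightarrow> 'a) set"
  assumes F: "perm_group F"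
    and trans_F: "transitive_on F"
    and gen_F: "gen_by_point_stabs F"
begin

abbreviation "U \<equiv> G2_grp adj c F F"
abbreviation "Ut \<equiv> type_pres adj U"

lemma U_iff: "g \<in> U \<longleftrightarrow> g \<in> aut adj \<and> (\<forall>v. lp g v \<in> F)"
  by (auto simp: G2_iff)

lemma Ut_iff: "g \<in> Ut \<longleftrightarrow> g \<in> U \<and> (\<forall>v. tp (g v) = tp v)"
  by (simp add: type_pres_eq)

lemma groups: "perm_group U" "perm_group Ut"
  using perm_group_G2 perm_group_type_pres F by auto

lemma U_aut: "g \<in> U \<Longrightarrow> g \<in> aut adj" and Ut_U: "g \<in> Ut \<Longrightarrow> g \<in> U" and Ut_aut: "g \<in> Ut \<Longrightarrow> g \<in> aut adj"
  by (simp_all add: Ut_iff U_iff)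

lemma UtI:
  assumes "g \<in> U" "tp (g v) = tp v"
  shows "g \<in> Ut"
  using aut_tp_pres[OF U_aut[OF assms(1)] assms(2)] assms(1) by (simp add: Ut_iff)

lemma const_element:
  assumes "f \<in> F"
  shows "\<exists>g\<in>U. g r = w \<and> (\<forall>x. lp g x = f)"
  using extension_const[OF perm_groupD(1)[OF F assms], of r w] assms by (auto simp: U_iff)

text \<open>A constant local permutation carrying one colour to the other does it; this is where
  transitivity of \<open>F\<close> enters.\<close>

lemma edge_transitive:
  assumes "adj x y" "adj x' y'"
  shows "\<exists>s\<in>U. s x = x' \<and> s y = y'"
proof -
  obtain f where f: "f \<in> F" "f (c {x, y}) = c {x', y'}" using trans_F unfolding transitive_on_def by blast
  obtain s where s: "s \<in> U" "s x = x'" "\<And>z. lp s z = f" using const_element[OF f(1)] by blast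
  have "s y = y'"
  proof (rule color_inj[OF _ assms(2)])
    show "adj x' (s y)" using autD(2)[OF U_aut[OF s(1)], of x y] s(2) assms(1) by simp
    show "c {x', s y} = c {x', y'}" using lp_app[OF assms(1), of s] s f by simp
  qed
  then show ?thesis using s by blast
qed

text \<open>Membership in \<open>U\<close> is a condition on stars, and injectivity and surjectivity
  come for free from \<open>local_iso\<close>.\<close>

lemma glue:
  assumes "\<And>z. \<exists>g\<in>U. f z = g z \<and> (\<forall>w. adj z w \<longrightarrow> f w = g w)"
  shows "f \<in> U"
proof -
  obtain g where g: "\<And>z. g z \<in> U" "\<And>z. f z = g z z" "\<And>z w. adj z w \<Longrightarrow> f w = g z w"
    using assms by metis
  have b: "bij (lp (g z) z)" for z using lp_bij[OF U_aut[OF g(1)]] .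
  have a: "adj (f z) (f w) \<and> c {f z, f w} = lp (g z) z (c {z, w})" if "adj z w" for z w
    using lp_app[OF that, of "g z"] autD(2)[OF U_aut[OF g(1)], of z z w] g(2)[of z] g(3)[OF that] that by simp
  show ?thesis using local_iso[where s = "\<lambda>z. lp (g z) z", OF b a] g(1) by (simp add: U_iff)
qed

text \<open>By \<open>T_nest\<close> the two conditions say that \<open>h\<close> maps
  \<open>T u v\<close> into itself: the edge lies on an axis of \<open>h\<close> and points in the
  direction of translation.\<close>

definition translates :: "('v \<Rightarrow> 'v) \<Rightarrow> 'v \<Rightarrow> 'v \<Rightarrow> bool" where
  "translates h u v \<longleftrightarrow> adj u v \<and> h u \<in> T u v \<and> u \<notin> T (h u) (h v)"

text \<open>The inverse moves along the axis the other way. Its edge ends in \<open>h u\<close>,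
  which has the type opposite to that of \<open>v\<close>.\<close>

lemma translates_finv:
  assumes h: "h \<in> Ut" and t: "translates h u v"
  shows "translates (finv h) (h v) (h u)"
proof -
  note ha = Ut_aut[OF h]
  have uv: "adj u v" "h u \<in> T u v" "u \<notin> T (h u) (h v)" using t by (auto simp: translates_def)
  have huv: "adj (h u) (h v)" using autD(2)[OF ha] uv(1) by simp
  have tps: "tp (h u) \<noteq> tp v" using h tp_adj[OF uv(1)] by (simp add: Ut_iff)
  have "v \<notin> T (h u) (h v)"
    using T_cross[OF huv _ uv(3) adj_sym[OF uv(1)]] uv(2) T_notin by metis
  moreover have "h v \<in> T u v" using T_cross[OF uv(1,2) _ huv] tps by metis
  ultimately show ?thesis
    using T_compl[OF huv, of v] T_compl[OF uv(1), of "h v"] adj_sym[OF huv] aut_finv(1)[OF ha]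
    by (simp add: translates_def)
qed

text \<open>\<open>h0\<close> fixes \<open>v\<close> and moves its neighbour \<open>y\<close>; a
  conjugate \<open>f\<close> fixes a vertex \<open>w\<close> on the other side of \<open>y\<close>
  and moves \<open>y\<close> too. The product of two such elements translates.\<close>

lemma translates_ex_fixed:
  assumes H: "perm_normal H Ut" and h0: "h0 \<in> H" "h0 \<noteq> id" and r: "h0 r = r"
  shows "\<exists>h\<in>H. \<exists>u v. translates h u v"
proof -
  have HU: "perm_group H" "H \<subseteq> Ut" using H by (auto simp: perm_normal_def)
  have h0a: "h0 \<in> aut adj" using h0 HU Ut_aut by blast
  have "\<exists>v y. h0 v = v \<and> adj v y \<and> h0 y \<noteq> y"
  proof (rule ccontr)
    assume a: "\<not> ?thesis"
    have "h0 z = z" for z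
      by (induction z rule: connected_induct[where r = r]) (use r a in auto)
    then show False using h0(2) by (auto simp: fun_eq_iff)
  qed
  then obtain v y where v: "h0 v = v" "adj v y" "h0 y \<noteq> y" by blast
  obtain w where w: "adj y w" "w \<noteq> v" using third_nbr by blast
  obtain k where k: "k \<in> U" "k y = y" "k v = w" using edge_transitive[OF adj_sym[OF v(2)] w(1)] by blast
  have kt: "k \<in> Ut" by (rule UtI[OF k(1), of y]) (simp add: k)
  note ka = U_aut[OF k(1)]
  define f where "f = k \<circ> h0 \<circ> finv k"
  have fH: "f \<in> H" using H h0 kt by (auto simp: perm_normal_def f_def)
  have fa: "f \<in> aut adj" using fH HU Ut_aut by blast
  have fk: "finv k w = v" "finv k y = y" using aut_finv(1)[OF ka] k(2,3) by metis+
  have f: "f w = w" "f y \<noteq> y"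
  proof -
    show "f w = w" by (simp add: f_def fk v k)
    show "f y \<noteq> y" using aut_inj[OF ka, of "h0 y" y] v(3) k(2) by (simp add: f_def fk)
  qed
  \<comment> \<open>The vertices \<open>u0\<close>, \<open>v0\<close>, \<open>v\<close>,
    \<open>y\<close>, \<open>w\<close>, \<open>f y\<close> form a walk without backtracking, and
    \<open>f \<circ> h0\<close> maps its first edge to its last.\<close>
  define u0 where "u0 = finv h0 w"
  define v0 where "v0 = finv h0 y"
  have uv0: "h0 u0 = w" "h0 v0 = y" using aut_finv(2)[OF h0a] by (simp_all add: u0_def v0_def)
  have adjs: "adj u0 v0" "adj v0 v" "adj w (f y)"
    using autD(2)[OF h0a, of u0 v0] autD(2)[OF h0a, of v0 v] autD(2)[OF fa, of w y] uv0 v f(1) w(1) adj_sym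
    by auto
  have ne: "v \<noteq> u0" "y \<noteq> v0" using uv0 v w by auto
  have "T y w \<subseteq> T v y" "T v y \<subseteq> T v0 v" "T v0 v \<subseteq> T u0 v0"
    using T_step[OF v(2) w(1) w(2)] T_step[OF adjs(2) v(2) ne(2)] T_step[OF adjs(1,2) ne(1)] by auto
  then have c: "T y w \<subseteq> T u0 v0" by blast
  have "y \<noteq> w" using w(1) adj_irrefl by blast
  then have "w \<in> T u0 v0" using c T_in by blast
  moreover have "u0 \<notin> T w (f y)" using T_step[OF w(1) adjs(3) f(2)] c T_notin by blast
  ultimately have "translates (f \<circ> h0) u0 v0" using adjs(1) uv0 f(1) by (simp add: translates_def)
  then show ?thesis using perm_groupD(3)[OF HU(1) fH h0(1)] by blast
qed

text \<open>At a vertex of least displacement \<open>n\<close>, which is even and so at least 2,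
  failure to translate would mean that the next vertex towards \<open>h v\<close> has displacement
  \<open>n - 2\<close>.\<close>

lemma translates_ex_no_fixed:
  assumes h: "h \<in> Ut" and nofix: "\<And>x. h x \<noteq> x"
  shows "\<exists>u v. translates h u v"
proof -
  note ha = Ut_aut[OF h]
  obtain v where min: "\<And>x. d v (h v) \<le> d x (h x)"
    using ex_has_least_nat[of "\<lambda>_. True" undefined "\<lambda>x. d x (h x)"] by auto
  define n where "n = d v (h v)"
  have "even n" using d_even_tp[of v "h v"] h by (simp add: Ut_iff n_def)
  moreover have "n \<noteq> 0" using nofix[of v] by (auto simp: n_def)
  ultimately obtain m where m: "n = Suc (Suc m)" by (metis even_Suc not0_implies_Suc odd_one One_nat_def)
  define p where "p = par (h v) v"
  have p: "adj v p" "d v (h v) = Suc (d p (h v))" using par[of v "h v"] nofix[of v] by (auto simp: p_def)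
  have dp: "d p (h v) = Suc m" using p(2) m n_def by simp
  then have "h v \<noteq> p" by auto
  then obtain q where q: "adj (h v) q" "d (h v) p = Suc (d q p)" using closer_ex by blast
  have dq: "d q p = m" using q(2) dp d_sym by simp
  have "v \<notin> T (h v) (h p)"
  proof
    assume "v \<in> T (h v) (h p)"
    then have "d (h p) v < d (h v) v" by (simp add: T_def d_sym)
    moreover have "d q v < d (h v) v"
      using d_adj'[OF p(1), of q] dq m n_def d_sym[of v "h v"] by arith
    moreover have "adj (h v) (h p)" using autD(2)[OF ha] p(1) by simp
    ultimately have "q = h p" using closer_unique[OF q(1)] by blast
    then have "d p (h p) = m" using dq d_sym by simp
    then show False using min[of p] m n_def by simp
  qed
  then have "translates h v p" using p by (simp add: translates_def T_def d_sym)
  then show ?thesis by blast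
qed

text \<open>If the translates \<open>h ^^ n ` A\<close> of a half-tree \<open>A\<close> are pairwise disjoint and \<open>k\<close> is supported
  on \<open>A\<close>, then \<open>f\<close>, the product of all conjugates of \<open>k\<close> by the powers \<open>h ^^ n\<close>, satisfies
  \<open>k = f \<circ> h \<circ> finv f \<circ> finv h\<close>.\<close>

lemma rigid_stabilizer_translated:
  assumes H: "perm_normal H Ut" and hH: "h \<in> H" and t: "translates h u v"
    and y: "adj v y" "y \<noteq> u" "y \<noteq> par (h u) v"
    and k: "k \<in> U" "\<And>z. z \<notin> T v y \<Longrightarrow> k z = z"
  shows "k \<in> H"
proof -
  have HU: "perm_group H" "H \<subseteq> Ut" using H by (auto simp: perm_normal_def)
  have hU: "h \<in> Ut" "h \<in> U" "h \<in> aut adj" using hH HU Ut_U U_aut by blast+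
  have uv: "adj u v" "h u \<in> T u v" "u \<notin> T (h u) (h v)" using t by (auto simp: translates_def)
  have huv: "adj (h u) (h v)" using autD(2)[OF hU(3)] uv(1) by simp
  have tps: "h u \<noteq> v" using hU(1) tp_adj[OF uv(1)] by (auto simp: Ut_iff)
  define A where "A = T v y"
  define B where "B = T u v"
  have hB: "h ` B = T (h u) (h v)" using aut_T_image[OF hU(3)] by (simp add: B_def)
  have hBB: "h ` B \<subseteq> B" using T_nest[OF uv(1) huv uv(2,3)] hB B_def by simp
  have AB: "A \<subseteq> B" unfolding A_def B_def by (rule T_step[OF uv(1) y(1,2)])
  have vhB: "v \<notin> h ` B"
    unfolding hB using T_cross[OF huv _ uv(3) adj_sym[OF uv(1)]] uv(2) T_notin by metis
  have yhB: "y \<notin> T (h u) (h v)"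
    using T_cross[OF huv _ vhB[unfolded hB] adj_sym[OF y(1)]] tps by metis
  have "h u \<notin> T v y"
    using par_eq[OF y(1), of "h u"] y(3) by (auto simp: T_def d_sym)
  then have "h u \<in> T y v" using T_compl[OF y(1)] by blast
  then have "T (h u) (h v) \<subseteq> T y v" by (rule T_nest[OF adj_sym[OF y(1)] huv _ yhB])
  then have AhB: "A \<inter> h ` B = {}" unfolding hB A_def using T_compl[OF y(1)] by blast
  have pow: "h ^^ n \<in> Ut" for n
  proof (induction n)
    case 0
    show ?case unfolding funpow.simps by (rule perm_groupD(2)[OF groups(2)])
  next
    case (Suc n)
    then show ?case unfolding funpow.simps by (rule perm_groupD(3)[OF groups(2) hU(1)])
  qed
  note powa = Ut_aut[OF pow]
  have powB: "(h ^^ n) b \<in> B" if "b \<in> B" for n b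
    by (induction n) (use that hBB in auto)
  have powhB: "(h ^^ Suc n) a \<in> h ` B" if "a \<in> A" for n a
    using powB[of a n] that AB by auto
  define An where "An n = (h ^^ n) ` A" for n
  have disj: "n = m" if z: "z \<in> An n" "z \<in> An m" for z n m
  proof -
    have clash: "False" if nm: "i < j" and "a \<in> A" "b \<in> A" and e: "(h ^^ i) a = (h ^^ j) b" for i j a b
    proof -
      obtain l where l: "j = i + Suc l" using nm less_iff_Suc_add by auto
      have "(h ^^ i) a = (h ^^ i) ((h ^^ Suc l) b)" using e unfolding l funpow_add by simp
      then have "a = (h ^^ Suc l) b" using aut_inj[OF powa] by blast
      then show False using powhB[OF \<open>b \<in> A\<close>, of l] \<open>a \<in> A\<close> AhB by (metis disjoint_iff)
    qed
    obtain a b where ab: "a \<in> A" "b \<in> A" "z = (h ^^ n) a" "z = (h ^^ m) b"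
      using z unfolding An_def by blast
    then show ?thesis using clash[of n m a b] clash[of m n b a] by (cases n m rule: linorder_cases) simp_all
  qed
  have AnT: "An n = T ((h ^^ n) v) ((h ^^ n) y)" for n
    unfolding An_def A_def by (rule aut_T_image[OF powa])
  have An_adj: "adj ((h ^^ n) v) ((h ^^ n) y)" for n using autD(2)[OF powa] y(1) by blast
  have ka: "k \<in> aut adj" using U_aut[OF k(1)] .
  have kA: "k a \<in> A" if "a \<in> A" for a
    using k(2)[of "k a"] aut_inj[OF ka] that unfolding A_def by metis
  have kv: "k v = v" using k(2)[of v] T_notin by blast
  have vy: "v \<noteq> y" using y(1) adj_irrefl by blast
  have ky: "k y = y"
  proof -
    have "k y \<in> T v y" using kA T_in[OF vy] by (simp add: A_def)
    moreover have "adj (k y) v" using autD(2)[OF ka, of y v] kv adj_sym[OF y(1)] by simp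
    ultimately show ?thesis using T_cross[OF y(1) _ T_notin] by blast
  qed
  define g where "g n = h ^^ n \<circ> k \<circ> finv (h ^^ n)" for n
  have gU: "g n \<in> U" for n
    using perm_groupD(3,4)[OF groups(1)] k(1) Ut_U[OF pow] by (simp add: g_def)
  have g: "g n ((h ^^ n) a) = (h ^^ n) (k a)" for n a
    using aut_finv(1)[OF powa] by (simp add: g_def)
  \<comment> \<open>The choice of \<open>n\<close> is unique because the translates are
    disjoint.\<close>
  define f where "f z = (if \<exists>n. z \<in> An n then g (SOME n. z \<in> An n) z else z)" for z
  have f1: "f z = g n z" if "z \<in> An n" for z n
  proof -
    have "(SOME n. z \<in> An n) = n" using that disj by blast
    then show ?thesis using that by (auto simp: f_def)
  qed
  have f2: "f z = z" if "\<And>n. z \<notin> An n" for z using that by (simp add: f_def)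
  have root: "g n ((h ^^ n) y) = (h ^^ n) y" "g n ((h ^^ n) v) = (h ^^ n) v" for n
    using g ky kv by simp_all
  \<comment> \<open>A translate can be entered only at its root \<open>(h ^^ m) y\<close>, and
    \<open>g m\<close> fixes the root.\<close>
  have enter: "f w = w" if w: "adj z w" "z \<notin> An m" "w \<in> An m" for z w m
  proof -
    have "w = (h ^^ m) y" using T_cross[OF An_adj, of w m z] w adj_sym by (simp add: AnT)
    then show ?thesis using f1[OF w(3)] root(1) by simp
  qed
  have fU: "f \<in> U"
  proof (rule glue)
    fix z
    show "\<exists>g\<in>U. f z = g z \<and> (\<forall>w. adj z w \<longrightarrow> f w = g w)"
    proof (cases "\<exists>n. z \<in> An n")
      case True
      then obtain n where n: "z \<in> An n" by blast
      have "f w = g n w" if zw: "adj z w" for w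
      proof (cases "w \<in> An n")
        case False
        then have "w = (h ^^ n) v" using T_cross[OF An_adj, of z n w] n zw by (simp add: AnT)
        then have "g n w = w" using root(2) by simp
        moreover have "f w = w"
        proof (cases "\<exists>m. w \<in> An m")
          case True
          then obtain m where m: "w \<in> An m" by blast
          then have "z \<notin> An m" using disj[OF n, of m] False by auto
          then show ?thesis using enter zw m by blast
        qed (use f2 in blast)
        ultimately show ?thesis by simp
      qed (rule f1)
      then show ?thesis using f1[OF n] gU by blast
    next
      case False
      then have "f w = w" if "adj z w" for w using enter[OF that] f2[of w] by blast
      moreover have "f z = z" using f2 False by blast
      ultimately show ?thesis using perm_groupD(2)[OF groups(1)] by (intro bexI[of _ id]) auto
    qed
  qed
  \<comment> \<open>A fixed vertex makes \<open>f\<close> type-preserving, as a conjugator for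
    \<open>H\<close> must be.\<close>
  have "v \<notin> An n" for n
  proof (cases n)
    case 0
    then show ?thesis using T_notin by (simp add: An_def A_def)
  next
    case (Suc i)
    then show ?thesis using powhB[of _ i] vhB by (auto simp: An_def simp del: funpow.simps)
  qed
  then have "f v = v" by (rule f2)
  then have fUt: "f \<in> Ut" using UtI[OF fU, of v] by simp
  note fa = U_aut[OF fU]
  \<comment> \<open>Conjugation by \<open>h\<close> shifts each factor of \<open>f\<close> by one
    exponent. Exponents start at 0, so only the factor \<open>k\<close> gets lost.\<close>
  have fh: "f (h z) = k (h (f z))" for z
  proof (cases "\<exists>n. z \<in> An n")
    case True
    then obtain n a where a: "a \<in> A" "z = (h ^^ n) a" by (auto simp: An_def)
    have hz: "h z = (h ^^ Suc n) a" using a by simp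
    have m: "(h ^^ Suc n) a \<in> An (Suc n)" unfolding An_def using a(1) by (rule imageI)
    have "f z = (h ^^ n) (k a)" using f1[of z n] g a by (simp add: An_def)
    then have e: "h (f z) = (h ^^ Suc n) (k a)" by simp
    have "(h ^^ Suc n) (k a) \<notin> A" using powhB[OF kA[OF a(1)], of n] AhB by blast
    then have "k (h (f z)) = (h ^^ Suc n) (k a)" unfolding e using k(2) by (simp add: A_def)
    moreover have "f (h z) = (h ^^ Suc n) (k a)" unfolding hz f1[OF m] by (rule g)
    ultimately show ?thesis by simp
  next
    case False
    then have fz: "f z = z" using f2 by blast
    show ?thesis
    proof (cases "h z \<in> A")
      case True
      then have "h z \<in> An 0" by (simp add: An_def)
      then have "f (h z) = g 0 (h z)" by (rule f1)
      then show ?thesis using fz g[of 0 "h z"] by simp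
    next
      case n: False
      have "h z \<notin> An m" for m
      proof (cases m)
        case (Suc i)
        show ?thesis
        proof
          assume "h z \<in> An m"
          then obtain a where "a \<in> A" "h z = h ((h ^^ i) a)" by (auto simp: An_def Suc)
          then have "z \<in> An i" using aut_inj[OF hU(3)] by (auto simp: An_def)
          then show False using False by blast
        qed
      qed (use n in \<open>simp add: An_def\<close>)
      then show ?thesis using f2[of "h z"] fz k(2)[of "h z"] n by (simp add: A_def)
    qed
  qed
  have "k z = (f \<circ> h \<circ> finv f \<circ> finv h) z" for z
    using fh[of "finv f (finv h z)"] aut_finv(2)[OF fa] aut_finv(2)[OF hU(3)] by simp
  then have "k = (f \<circ> h \<circ> finv f) \<circ> finv h" by (simp add: fun_eq_iff)
  moreover have "f \<circ> h \<circ> finv f \<in> H" using H hH fUt by (auto simp: perm_normal_def)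
  ultimately show ?thesis using perm_groupD(3,4)[OF HU(1)] hH by metis
qed

text \<open>The type of \<open>v\<close> has to be at choice because \<open>H\<close> is normal only
  in \<open>Ut\<close>, whose elements cannot carry a half-tree to one rooted at the other type.
  Passing to the inverse switches the type.\<close>

lemma translates_ex:
  assumes H: "perm_normal H Ut" "H \<noteq> {id}"
  shows "\<exists>h\<in>H. \<exists>u v. translates h u v \<and> tp v = b"
proof -
  have HU: "perm_group H" "H \<subseteq> Ut" using H by (auto simp: perm_normal_def)
  obtain h0 where h0: "h0 \<in> H" "h0 \<noteq> id" using H(2) perm_groupD(2)[OF HU(1)] by blast
  have "\<exists>h\<in>H. \<exists>u v. translates h u v"
  proof (cases "\<exists>r. h0 r = r")
    case True
    then show ?thesis using translates_ex_fixed[OF H(1) h0] by blast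
  next
    case False
    then show ?thesis using translates_ex_no_fixed[of h0] h0(1) HU(2) by blast
  qed
  then obtain h u v where h: "h \<in> H" "translates h u v" by blast
  show ?thesis
  proof (cases "tp v = b")
    case True
    then show ?thesis using h by blast
  next
    case False
    have hU: "h \<in> Ut" using h HU by blast
    have "tp (h u) = b" using hU False tp_adj[of u v] h(2) by (auto simp: Ut_iff translates_def)
    then show ?thesis using translates_finv[OF hU h(2)] perm_groupD(4)[OF HU(1) h(1)] by blast
  qed
qed

lemma rigid_stabilizer:
  assumes H: "perm_normal H Ut" "H \<noteq> {id}" and pq: "adj p q"
    and k: "k \<in> U" "\<And>z. z \<notin> T p q \<Longrightarrow> k z = z"
  shows "k \<in> H"
proof -
  obtain h u v where h: "h \<in> H" "translates h u v" "tp v = tp p" using translates_ex[OF H] by blast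
  \<comment> \<open>The directions of \<open>u\<close> and of \<open>h u\<close> belong to the axis;
    behind any other neighbour the translates of the half-tree are disjoint.\<close>
  obtain y where y: "adj v y" "y \<noteq> u" "y \<noteq> par (h u) v" using third_nbr by blast
  obtain s where s: "s \<in> U" "s v = p" "s y = q" using edge_transitive[OF y(1) pq] by blast
  have st: "s \<in> Ut" using UtI[OF s(1), of v] s(2) h(3) by simp
  note sa = U_aut[OF s(1)]
  have "finv s \<circ> k \<circ> s \<in> H"
  proof (rule rigid_stabilizer_translated[OF H(1) h(1,2) y])
    show "finv s \<circ> k \<circ> s \<in> U" using perm_groupD(3,4)[OF groups(1)] s(1) k(1) by blast
    fix z assume "z \<notin> T v y"
    then have "s z \<notin> T p q" using aut_T[OF sa, of z v y] s by simp
    then show "(finv s \<circ> k \<circ> s) z = z" using k(2) aut_finv(1)[OF sa] by simp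
  qed
  then have "s \<circ> (finv s \<circ> k \<circ> s) \<circ> finv s \<in> H" using H(1) st by (auto simp: perm_normal_def)
  moreover have "s \<circ> (finv s \<circ> k \<circ> s) \<circ> finv s = k"
    by (rule ext) (simp add: aut_finv(2)[OF sa])
  ultimately show ?thesis by simp
qed

text \<open>By independence \<open>g\<close> is the product of its restrictions to the two sides of
  the edge, each supported on a half-tree.\<close>

lemma edge_stabilizer_normal:
  assumes H: "perm_normal H Ut" "H \<noteq> {id}" and uv: "adj u v"
    and g: "g \<in> U" "g u = u" "g v = v"
  shows "g \<in> H"
proof -
  note ga = U_aut[OF g(1)]
  define g1 where "g1 x = (if x \<in> T u v then x else g x)" for x
  define g2 where "g2 x = (if x \<in> T v u then x else g x)" for x
  have "g1 \<in> U" "g2 \<in> U"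
    using edge_independence[OF ga uv g(2,3)] edge_independence[OF ga adj_sym[OF uv] g(3,2)] g(1)
      perm_groupD(2)[OF F] by (auto simp: U_iff g1_def[abs_def] g2_def[abs_def])
  then have "g1 \<in> H" "g2 \<in> H"
    using rigid_stabilizer[OF H adj_sym[OF uv], of g1] rigid_stabilizer[OF H uv, of g2] T_compl[OF uv]
    by (auto simp: g1_def g2_def)
  moreover have "g = g1 \<circ> g2"
  proof
    fix x show "g x = (g1 \<circ> g2) x"
      using aut_T[OF ga, of x u v] g(2,3) T_compl[OF uv, of x] by (simp add: g1_def g2_def)
  qed
  moreover have "perm_group H" using H by (simp add: perm_normal_def)
  ultimately show ?thesis using perm_groupD(3) by blast
qed

text \<open>The permutations \<open>f\<close> in \<open>F\<close> all of whose realisations fixing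
  \<open>v\<close> lie in \<open>H\<close> form a group: for products, an element with constant
  local permutation \<open>f\<close> is split off. It contains the point stabilizers, since fixing a
  colour means fixing an edge, and these generate \<open>F\<close>.\<close>

lemma vertex_stabilizer_normal:
  assumes H: "perm_normal H Ut" "H \<noteq> {id}" and g: "g \<in> U" "g v = v"
  shows "g \<in> H"
proof -
  have HU: "perm_group H" using H by (simp add: perm_normal_def)
  define P where "P f \<longleftrightarrow> f \<in> F \<and> (\<forall>g\<in>U. g v = v \<longrightarrow> lp g v = f \<longrightarrow> g \<in> H)" for f
  have fixed: "g \<in> H" if "g \<in> U" "g v = v" "lp g v a = a" for g a
  proof (rule edge_stabilizer_normal[OF H nbr(1)[of v a] that(1,2)])
    show "g (nbr v a) = nbr v a"
    proof (rule color_inj[of v])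
      show "adj v (g (nbr v a))" using autD(2)[OF U_aut[OF that(1)], of v "nbr v a"] nbr(1) that(2) by simp
      show "c {v, g (nbr v a)} = c {v, nbr v a}"
        using lp_app[OF nbr(1)[of v a], of g] that(2,3) nbr(2)[of v a] by simp
    qed (rule nbr(1))
  qed
  have st: "P f" if "f \<in> F" "f a = a" for f a using that fixed by (auto simp: P_def)
  let ?X = "\<Union>x. {f \<in> F. f x = x}"
  have bX: "bij f" if "f \<in> ?X" for f using that perm_groupD(1)[OF F] by auto
  have "perm_group {f. P f}"
    unfolding perm_group_def
  proof (intro conjI ballI)
    show "{f. P f} \<subseteq> {g. bij g}" using perm_groupD(1)[OF F] by (auto simp: P_def)
    show "id \<in> {f. P f}" using st[OF perm_groupD(2)[OF F]] by simp
    show "finv f \<in> {f. P f}" if "f \<in> {f. P f}" for f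
    proof -
      have f: "f \<in> F" "\<And>g. g \<in> U \<Longrightarrow> g v = v \<Longrightarrow> lp g v = f \<Longrightarrow> g \<in> H" using that by (auto simp: P_def)
      have "g \<in> H" if g: "g \<in> U" "g v = v" "lp g v = finv f" for g
      proof -
        have "lp (finv g) v = f"
          using lp_finv[OF U_aut[OF g(1)], of v] g(2,3) perm_groupD(1)[OF F f(1)] by simp
        moreover have "finv g v = v" using aut_finv(1)[OF U_aut[OF g(1)], of v] g(2) by simp
        ultimately have "finv g \<in> H" using f(2) perm_groupD(4)[OF groups(1) g(1)] by blast
        then show ?thesis using perm_groupD(4)[OF HU, of "finv g"] autD(1)[OF U_aut[OF g(1)]] by simp
      qed
      then show ?thesis using perm_groupD(4)[OF F f(1)] by (simp add: P_def)
    qed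
    show "f \<circ> f' \<in> {f. P f}" if "f \<in> {f. P f}" "f' \<in> {f. P f}" for f f'
    proof -
      have f: "f \<in> F" "\<And>g. g \<in> U \<Longrightarrow> g v = v \<Longrightarrow> lp g v = f \<Longrightarrow> g \<in> H" using that by (auto simp: P_def)
      have f': "f' \<in> F" "\<And>g. g \<in> U \<Longrightarrow> g v = v \<Longrightarrow> lp g v = f' \<Longrightarrow> g \<in> H" using that by (auto simp: P_def)
      have "g \<in> H" if g: "g \<in> U" "g v = v" "lp g v = f \<circ> f'" for g
      proof -
        obtain k where k: "k \<in> U" "k v = v" "\<And>x. lp k x = f" using const_element[OF f(1), of v v] by blast
        note kk = U_aut[OF k(1)]
        have kv: "finv k v = v" using aut_finv(1)[OF kk, of v] k(2) by simp
        have "lp (finv k \<circ> g) v = finv f \<circ> (f \<circ> f')"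
          using lp_comp[OF U_aut[OF g(1)], of "finv k" v] lp_finv[OF kk, of v] k(2,3) g(2,3) by simp
        also have "\<dots> = f'" using perm_groupD(1)[OF F f(1)] by (simp add: comp_assoc[symmetric] bij_is_inj)
        finally have "finv k \<circ> g \<in> H"
          using f'(2) perm_groupD(3,4)[OF groups(1)] k(1) g(1,2) kv by simp
        then have "k \<circ> (finv k \<circ> g) \<in> H" using perm_groupD(3)[OF HU] f(2)[OF k(1,2)] k(3) by blast
        moreover have "k \<circ> (finv k \<circ> g) = g" by (rule ext) (simp add: aut_finv(2)[OF kk])
        ultimately show ?thesis by simp
      qed
      then show ?thesis using perm_groupD(3)[OF F f(1) f'(1)] by (simp add: P_def)
    qed
  qed
  moreover have "?X \<subseteq> {f. P f}" using st by blast
  ultimately have "generate (PG {f. bij f}) ?X \<subseteq> {f. P f}"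
    using generate_least[OF perm_group_bij] bX by blast
  moreover have "generate (PG {f. bij f}) ?X = F"
    using gen_F unfolding gen_by_point_stabs_def by (metis PG_SymG)
  moreover have "lp g v \<in> F" using g(1) by (simp add: U_iff)
  ultimately have "P (lp g v)" by blast
  then show ?thesis using g by (simp add: P_def)
qed

text \<open>Vertices of equal type are reached in steps of length two, each by a rotation about the
  middle vertex; such rotations lie in \<open>H\<close>.\<close>

lemma normal_transitive:
  assumes H: "perm_normal H Ut" "H \<noteq> {id}" and "tp r = tp w"
  shows "\<exists>h\<in>H. h r = w"
  using assms(3)
proof (induction "d w r" arbitrary: w rule: less_induct)
  case less
  have HU: "perm_group H" using H by (simp add: perm_normal_def)
  show ?case
  proof (cases "w = r")
    case True
    then show ?thesis using perm_groupD(2)[OF HU] by (intro bexI[of _ id]) auto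
  next
    case False
    then obtain z where z: "adj w z" "d w r = Suc (d z r)" using closer_ex by blast
    have "z \<noteq> r" using less.prems tp_adj[OF z(1)] by auto
    then obtain z' where z': "adj z z'" "d z r = Suc (d z' r)" using closer_ex by blast
    have "tp r = tp z'" using less.prems tp_adj[OF z(1)] tp_adj[OF z'(1)] by auto
    then obtain h where h: "h \<in> H" "h r = z'" using less.hyps[of z'] z z' by auto
    obtain g where g: "g \<in> U" "g z = z" "g z' = w" using edge_transitive[OF z'(1) adj_sym[OF z(1)]] by blast
    have "g \<in> H" by (rule vertex_stabilizer_normal[OF H g(1,2)])
    then show ?thesis using perm_groupD(3)[OF HU _ h(1)] h(2) g(3) by (intro bexI[of _ "g \<circ> h"]) auto
  qed
qed

lemma Ut_simple: "simple_abs (PG Ut)"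
  unfolding simple_PG_iff[OF groups(2)]
proof (intro conjI allI impI)
  obtain u v where uv: "adj u v" using nbr by blast
  obtain w where w: "adj v w" "w \<noteq> u" using third_nbr by blast
  obtain s where s: "s \<in> U" "s v = v" "s u = w" using edge_transitive[OF adj_sym[OF uv] w(1)] by blast
  then have "s \<in> Ut" "s \<noteq> id" using UtI[OF s(1), of v] w(2) by auto
  then show "Ut \<noteq> {id}" by blast
next
  fix H assume H: "perm_normal H Ut"
  show "H = Ut \<or> H = {id}"
  proof (cases "H = {id}")
    case False
    have HU: "perm_group H" "H \<subseteq> Ut" using H by (auto simp: perm_normal_def)
    have "g \<in> H" if g: "g \<in> Ut" for g
    proof -
      fix r :: 'v
      obtain h where h: "h \<in> H" "h r = g r"
        using normal_transitive[OF H False, of r "g r"] g by (auto simp: Ut_iff)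
      have ha: "h \<in> aut adj" "h \<in> U" using h HU Ut_aut Ut_U by blast+
      have "finv h \<circ> g \<in> U" using perm_groupD(3,4)[OF groups(1)] ha(2) Ut_U[OF g] by blast
      moreover have "(finv h \<circ> g) r = r" using aut_finv(1)[OF ha(1), of r] h(2) by simp
      ultimately have "finv h \<circ> g \<in> H" by (rule vertex_stabilizer_normal[OF H False])
      then have "h \<circ> (finv h \<circ> g) \<in> H" using perm_groupD(3)[OF HU(1)] h(1) by blast
      moreover have "h \<circ> (finv h \<circ> g) = g" by (rule ext) (simp add: aut_finv(2)[OF ha(1)])
      ultimately show ?thesis by simp
    qed
    then show ?thesis using HU by blast
  qed simp
qed

end

theorem mainTheorem2:
  fixes adj :: "'v \<Rightarrow> 'v \<Rightarrow> bool" and c :: "'v set \<Rightarrow> 'a::finite"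
  assumes "card (UNIV :: 'a set) \<ge> 3"
    and "is_tree adj"
    and "legal_coloring adj c"
  shows
    "(\<forall>F F'' F' :: ('a \<Rightarrow> 'a) set.
        subgroup F SymG \<and> subgroup F'' SymG \<and> subgroup F' SymG \<and>
        F \<subseteq> F'' \<and> F'' \<subseteq> F' \<and> F' \<subseteq> hat F \<and>
        index (SymG\<lparr>carrier := F'\<rparr>) F'' = 2 \<and>
        simple_abs ((autG adj)\<lparr>carrier := type_pres adj (G2_grp adj c F F'')\<rparr>)
      \<longrightarrow> subgroup (N_grp adj c F F') ((autG adj)\<lparr>carrier := G2_grp adj c F F'\<rparr>) \<and>
          simple_abs ((autG adj)\<lparr>carrier := N_grp adj c F F'\<rparr>) \<and>
          index ((autG adj)\<lparr>carrier := G2_grp adj c F F'\<rparr>) (N_grp adj c F F') = 8)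
   \<and>
    (\<forall>F F' :: ('a \<Rightarrow> 'a) set.
        subgroup F SymG \<and> subgroup F' SymG \<and> F \<subseteq> F' \<and> F' \<subseteq> hat F \<and>
        index (SymG\<lparr>carrier := F'\<rparr>) F = 2 \<and>
        transitive_on F \<and> gen_by_point_stabs F
      \<longrightarrow> (\<exists>N. subgroup N ((autG adj)\<lparr>carrier := G2_grp adj c F F'\<rparr>) \<and>
               simple_abs ((autG adj)\<lparr>carrier := N\<rparr>) \<and>
               index ((autG adj)\<lparr>carrier := G2_grp adj c F F'\<rparr>) N = 8))"
proof -
  have tree: "colored_tree adj c" using assms by unfold_locales
  have aut_PG: "(autG adj)\<lparr>carrier := A\<rparr> = PG A" for A by (simp add: autG_def)
  have first: "subgroup (N_grp adj c F F') (PG (G2_grp adj c F F')) \<and>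
      simple_abs (PG (N_grp adj c F F')) \<and> index (PG (G2_grp adj c F F')) (N_grp adj c F F') = 8"
    if "subgroup F SymG" "subgroup F'' SymG" "subgroup F' SymG"
      "F \<subseteq> F''" "F'' \<subseteq> F'" "F' \<subseteq> hat F" "index (PG F') F'' = 2"
      "simple_abs (PG (type_pres adj (G2_grp adj c F F'')))" for F F'' F' :: "('a \<Rightarrow> 'a) set"
  proof -
    have "index_two_data adj c F F'' F'"
      using tree that(4-8) that(1-3)[THEN subgroup_SymG]
      by (simp add: index_two_data_def index_two_data_axioms_def)
    then show ?thesis using index_two_data.index_two_result by blast
  qed
  have second: "\<exists>N. subgroup N (PG (G2_grp adj c F F')) \<and> simple_abs (PG N) \<and>
      index (PG (G2_grp adj c F F')) N = 8"
    if "subgroup F SymG" "subgroup F' SymG" "F \<subseteq> F'" "F' \<subseteq> hat F" "index (PG F') F = 2"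
      "transitive_on F" "gen_by_point_stabs F" for F F' :: "('a \<Rightarrow> 'a) set"
  proof -
    have "tits adj c F"
      using tree that(6,7) subgroup_SymG[OF that(1)] by (simp add: tits_def tits_axioms_def)
    \<comment> \<open>For F'' = F the group \<open>G2_grp adj c F F\<close> is U(F), so this
      supplies hypothesis (b) of the first part.\<close>
    then have "simple_abs (PG (type_pres adj (G2_grp adj c F F)))" by (rule tits.Ut_simple)
    then show ?thesis using first[of F F F'] that by blast
  qed
  show ?thesis unfolding aut_PG using first second by blast
qed

end
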